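(* Let $M$ be a smooth manifold and $G$ a Lie group. A classical principal $G$-bundle over $M$ is exactly the same as a principal $G$-bundle $(E,M,q,(\alpha_i)_{i\in I},(\tau_{ij})_{i,j\in I})$ over $M$ in the join restriction category $\mathrm{ParMfld}$ that is totally fibred and for which the projection map $q:E\to M$ is surjective. Here the trivializations $\alpha_i:q^{-1}(U_i)\to U_i\times G$ of a classical bundle are regarded as partial maps $E\to M\times G$ with domain $q^{-1}(U_i)$, the maps $\tau_{ij}:U_i\cap U_j\to G$ as partial maps $M\to G$ with domain $U_i\cap U_j$, and the open set $U_i$ corresponds to the restriction idempotent $e_i:M\to M$ (the partial identity on $U_i$).
   Context: Composition is written in diagrammatic order: $fg$ means first $f$, then $g$. $\mathrm{ParMfld}$: objects are smooth manifolds; morphisms $A\to B$ are smooth maps $U\to B$ from open subsets $U\subseteq A$; composition is that of partial maps; the restriction $\bar f$ of $f:A\to B$ with domain $U$ is the partial identity of $A$ with domain $U$. Here $f\le g$ means $f$ is a restriction of $g$; a family of pairwise compatible maps (agreeing on overlaps of domains) has a join $\bigvee$, their union; $f$ is total if $\bar f=1$; a restriction idempotent is an $e$ with $e=\bar e$; $f$ is a partial isomorphism with partial inverse $f^*$ if $ff^*=\bar f$, $f^*f=\overline{f^*}$. For partial maps, $\langle f,g\rangle$ is defined on the intersection of the domains. Categorical notions. A fibre bundle over $M$ with typical fibre $F$ is an object $E$ with a total map $q:E\to M$ and partial isomorphisms $\alpha_i:E\to M\times F$ ($i\in I$) with $\alpha_i\pi_0=\bar\alpha_iq$, $\bigvee_i\bar\alpha_i=1_E$,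 and for each $i$ a restriction idempotent $e_i:M\to M$ with $\overline{\alpha_i^*}=e_i\times1_F$. It is totally fibred if $\bar\alpha_i=\overline{qe_i}$ for all $i$. For a group object $(G,m,u,\iota)$ with total structure maps, a $G$-atlas on $M$ is a family $\tau_{ij}:M\to G$ with $\langle\tau_{ij},\tau_{jk}\rangle m\le\tau_{ik}$, $\tau_{ii}\le\,!u$, $\tau_{ji}=\tau_{ij}\iota$. A principal $G$-bundle over $M$ is a fibre bundle with fibre $G$ and a $G$-atlas $(\tau_{ij})$ such that $\alpha_i^*\alpha_j=\langle\pi_0,\langle\pi_0\tau_{ji},\pi_1\rangle m\rangle:M\times G\to M\times G$. Classical notions. A classical fibre bundle $(E,q,M,F)$ consists of manifolds $E,M,F$ and a smooth map $q:E\to M$ such that each $x\in M$ has an open neighbourhood $U$ with a diffeomorphism $\alpha:q^{-1}(U)\to U\times F$ over $U$. A classical $G$-bundle structure on it consists of a smooth left action $a:G\times F\to F$ and a fibre bundle atlas $(U_i,\alpha_i)$ (an open cover with such diffeomorphisms) for which there are smooth maps $\tau_{ij}:U_i\cap U_j\to G$ with $\tau_{ij}(x)\tau_{jk}(x)=\tau_{ik}(x)$ on $U_i\cap U_j\cap U_k$, $\tau_{ii}(x)=u$, such that the transition functions ($(\alpha_i\circ\alpha_j^{-1})(x,f)=(x,u_{ij}(x,f))$ in ordinary notation) are $u_{ij}(x,f)=a(\tau_{ij}(x),f)$. A classical principal $G$-bundle is a classical $G$-bundle with fibre $G$ and action the left multiplication. *)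

theory Defs
  imports "HOL-Analysis.Analysis" "HOL-Algebra.Group"
begin

section \<open>Smooth manifolds\<close>

text \<open>Charts take values in the open subsets of \<^term>\<open>Euclidean_space n\<close>, which consists of the
  functions \<^typ>\<open>nat \<Rightarrow> real\<close> vanishing from \<^term>\<open>n\<close> on.  Carrying the dimension as a number rather
  than as a type admits dimension 0 (discrete groups, the terminal object) and all products.\<close>

definition partial_deriv :: "nat \<Rightarrow> ((nat \<Rightarrow> real) \<Rightarrow> real) \<Rightarrow> (nat \<Rightarrow> real) \<Rightarrow> real" where
  "partial_deriv i f x = deriv (\<lambda>t. f (x(i := t))) (x i)"

text \<open>\<open>Ck k n S f\<close>: the function \<open>f\<close> is of class $C^k$ on \<open>S\<close>, where \<open>S\<close> is open in
  \<^term>\<open>Euclidean_space n\<close>.  For such \<open>S\<close> the derivatives at points of \<open>S\<close> only depend on the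
  values of \<open>f\<close> on \<open>S\<close>.\<close>

primrec Ck :: "nat \<Rightarrow> nat \<Rightarrow> (nat \<Rightarrow> real) set \<Rightarrow> ((nat \<Rightarrow> real) \<Rightarrow> real) \<Rightarrow> bool" where
  "Ck 0 n S f \<longleftrightarrow> continuous_map (subtopology (Euclidean_space n) S) euclideanreal f"
| "Ck (Suc k) n S f \<longleftrightarrow>
     continuous_map (subtopology (Euclidean_space n) S) euclideanreal f \<and>
     (\<forall>i<n. (\<forall>x\<in>S. (\<lambda>t. f (x(i := t))) differentiable (at (x i))) \<and> Ck k n S (partial_deriv i f))"

definition smooth_on_Euclidean ::
    "nat \<Rightarrow> nat \<Rightarrow> (nat \<Rightarrow> real) set \<Rightarrow> ((nat \<Rightarrow> real) \<Rightarrow> (nat \<Rightarrow> real)) \<Rightarrow> bool" where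
  "smooth_on_Euclidean n m S f \<longleftrightarrow> (\<forall>j<m. \<forall>k. Ck k n S (\<lambda>x. f x j))"

record 'a mfld =
  mtop :: "'a topology"
  mdim :: nat
  charts :: "('a set \<times> ('a \<Rightarrow> nat \<Rightarrow> real)) set"

abbreviation pts :: "'a mfld \<Rightarrow> 'a set" where
  "pts A \<equiv> topspace (mtop A)"

definition is_chart :: "'a topology \<Rightarrow> nat \<Rightarrow> 'a set \<Rightarrow> ('a \<Rightarrow> nat \<Rightarrow> real) \<Rightarrow> bool" where
  "is_chart X n U \<phi> \<longleftrightarrow>
     openin X U \<and> openin (Euclidean_space n) (\<phi> ` U) \<and>
     homeomorphic_map (subtopology X U) (subtopology (Euclidean_space n) (\<phi> ` U)) \<phi>"

text \<open>The smooth structure is given by an atlas, which need not be maximal; smoothness of maps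
  (see below) is invariant under passing to an equivalent atlas.\<close>

definition smooth_manifold :: "'a mfld \<Rightarrow> bool" where
  "smooth_manifold A \<longleftrightarrow>
     Hausdorff_space (mtop A) \<and> second_countable (mtop A) \<and>
     (\<forall>(U, \<phi>) \<in> charts A. is_chart (mtop A) (mdim A) U \<phi>) \<and>
     (\<Union>(U, \<phi>) \<in> charts A. U) = pts A \<and>
     (\<forall>(U, \<phi>) \<in> charts A. \<forall>(V, \<psi>) \<in> charts A.
        smooth_on_Euclidean (mdim A) (mdim A) (\<phi> ` (U \<inter> V)) (\<psi> \<circ> inv_into U \<phi>))"

definition smooth_map :: "'a mfld \<Rightarrow> 'b mfld \<Rightarrow> ('a \<Rightarrow> 'b) \<Rightarrow> bool" where
  "smooth_map A B f \<longleftrightarrow>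
     continuous_map (mtop A) (mtop B) f \<and>
     (\<forall>(U, \<phi>) \<in> charts A. \<forall>(V, \<psi>) \<in> charts B.
        smooth_on_Euclidean (mdim A) (mdim B) (\<phi> ` {x \<in> U. f x \<in> V}) (\<psi> \<circ> f \<circ> inv_into U \<phi>))"

definition diffeo :: "'a mfld \<Rightarrow> 'b mfld \<Rightarrow> ('a \<Rightarrow> 'b) \<Rightarrow> bool" where
  "diffeo A B f \<longleftrightarrow>
     bij_betw f (pts A) (pts B) \<and> smooth_map A B f \<and> smooth_map B A (inv_into (pts A) f)"

definition open_submfld :: "'a mfld \<Rightarrow> 'a set \<Rightarrow> 'a mfld" where
  "open_submfld A S =
     \<lparr>mtop = subtopology (mtop A) S, mdim = mdim A, charts = {(U \<inter> S, \<phi>) |U \<phi>. (U, \<phi>) \<in> charts A}\<rparr>"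

definition prod_mfld :: "'a mfld \<Rightarrow> 'b mfld \<Rightarrow> ('a \<times> 'b) mfld" where
  "prod_mfld A B =
     \<lparr>mtop = prod_topology (mtop A) (mtop B), mdim = mdim A + mdim B,
      charts = {(U \<times> V, \<lambda>(x, y) i. if i < mdim A then \<phi> x i else \<psi> y (i - mdim A))
                |U \<phi> V \<psi>. (U, \<phi>) \<in> charts A \<and> (V, \<psi>) \<in> charts B}\<rparr>"

definition point_mfld :: "unit mfld" where
  "point_mfld = \<lparr>mtop = discrete_topology UNIV, mdim = 0, charts = {(UNIV, \<lambda>_ _. 0)}\<rparr>"


section \<open>The join restriction category \<open>ParMfld\<close>\<close>

text \<open>Its objects are the smooth manifolds.  An arrow is a partial function \<^typ>\<open>'a \<rightharpoonup> 'b\<close>, its source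
  and target being supplied where they matter; composition is in diagrammatic order.\<close>

definition pmap :: "'a set \<Rightarrow> ('a \<Rightarrow> 'b) \<Rightarrow> ('a \<rightharpoonup> 'b)" where
  "pmap S f = (Some \<circ> f) |` S"

definition mor :: "'a mfld \<Rightarrow> 'b mfld \<Rightarrow> ('a \<rightharpoonup> 'b) \<Rightarrow> bool" where
  "mor A B f \<longleftrightarrow>
     openin (mtop A) (dom f) \<and> smooth_map (open_submfld A (dom f)) B (\<lambda>x. the (f x))"

definition pcomp :: "('a \<rightharpoonup> 'b) \<Rightarrow> ('b \<rightharpoonup> 'c) \<Rightarrow> ('a \<rightharpoonup> 'c)" (infixl "\<Zsemi>" 75) where
  "f \<Zsemi> g = g \<circ>\<^sub>m f"

definition ident :: "'a mfld \<Rightarrow> ('a \<rightharpoonup> 'a)" where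
  "ident A = pmap (pts A) (\<lambda>x. x)"

definition rst :: "('a \<rightharpoonup> 'b) \<Rightarrow> ('a \<rightharpoonup> 'a)" where
  "rst f = pmap (dom f) (\<lambda>x. x)"

definition total :: "'a mfld \<Rightarrow> ('a \<rightharpoonup> 'b) \<Rightarrow> bool" where
  "total A f \<longleftrightarrow> rst f = ident A"

definition rle :: "('a \<rightharpoonup> 'b) \<Rightarrow> ('a \<rightharpoonup> 'b) \<Rightarrow> bool" (infix "\<sqsubseteq>\<^sub>r" 50) where
  "f \<sqsubseteq>\<^sub>r g \<longleftrightarrow> rst f \<Zsemi> g = f"

text \<open>The union of the graphs; this is the join when the family is pairwise compatible.\<close>

definition pjoin :: "'i set \<Rightarrow> ('i \<Rightarrow> 'a \<rightharpoonup> 'b) \<Rightarrow> ('a \<rightharpoonup> 'b)" where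
  "pjoin I f = (\<lambda>x. if \<exists>i\<in>I. x \<in> dom (f i) then Some (THE y. \<exists>i\<in>I. f i x = Some y) else None)"

definition restriction_idempotent :: "'a mfld \<Rightarrow> ('a \<rightharpoonup> 'a) \<Rightarrow> bool" where
  "restriction_idempotent A e \<longleftrightarrow> mor A A e \<and> e = rst e"

definition partial_inverse :: "'a mfld \<Rightarrow> 'b mfld \<Rightarrow> ('a \<rightharpoonup> 'b) \<Rightarrow> ('b \<rightharpoonup> 'a) \<Rightarrow> bool" where
  "partial_inverse A B f g \<longleftrightarrow> mor A B f \<and> mor B A g \<and> f \<Zsemi> g = rst f \<and> g \<Zsemi> f = rst g"

definition partial_iso :: "'a mfld \<Rightarrow> 'b mfld \<Rightarrow> ('a \<rightharpoonup> 'b) \<Rightarrow> bool" where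
  "partial_iso A B f \<longleftrightarrow> (\<exists>g. partial_inverse A B f g)"

text \<open>Partial inverses are unique, which justifies the description.\<close>

definition pinv :: "'a mfld \<Rightarrow> 'b mfld \<Rightarrow> ('a \<rightharpoonup> 'b) \<Rightarrow> ('b \<rightharpoonup> 'a)" where
  "pinv A B f = (THE g. partial_inverse A B f g)"

definition pi0 :: "'a mfld \<Rightarrow> 'b mfld \<Rightarrow> ('a \<times> 'b \<rightharpoonup> 'a)" where
  "pi0 A B = pmap (pts A \<times> pts B) fst"

definition pi1 :: "'a mfld \<Rightarrow> 'b mfld \<Rightarrow> ('a \<times> 'b \<rightharpoonup> 'b)" where
  "pi1 A B = pmap (pts A \<times> pts B) snd"

definition ppair :: "('a \<rightharpoonup> 'b) \<Rightarrow> ('a \<rightharpoonup> 'c) \<Rightarrow> ('a \<rightharpoonup> 'b \<times> 'c)" where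
  "ppair f g = pmap (dom f \<inter> dom g) (\<lambda>x. (the (f x), the (g x)))"

text \<open>\<open>pprod A B f g\<close> is \<open>f \<times> g\<close> for arrows \<open>f\<close> out of \<open>A\<close> and \<open>g\<close> out of \<open>B\<close>.\<close>

definition pprod :: "'a mfld \<Rightarrow> 'b mfld \<Rightarrow> ('a \<rightharpoonup> 'c) \<Rightarrow> ('b \<rightharpoonup> 'd) \<Rightarrow> ('a \<times> 'b \<rightharpoonup> 'c \<times> 'd)" where
  "pprod A B f g = ppair (pi0 A B \<Zsemi> f) (pi1 A B \<Zsemi> g)"

definition bang :: "'a mfld \<Rightarrow> ('a \<rightharpoonup> unit)" where
  "bang A = pmap (pts A) (\<lambda>_. ())"


section \<open>Principal bundles in \<open>ParMfld\<close>\<close>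

record 'g group_obj =
  gobj :: "'g mfld"
  gmul :: "'g \<times> 'g \<rightharpoonup> 'g"
  gunit :: "unit \<rightharpoonup> 'g"
  ginv :: "'g \<rightharpoonup> 'g"

definition group_object :: "'g group_obj \<Rightarrow> bool" where
  "group_object K \<longleftrightarrow>
    (let G = gobj K; m = gmul K; u = gunit K; \<iota> = ginv K; GG = prod_mfld G G in
      smooth_manifold G \<and>
      mor GG G m \<and> total GG m \<and>
      mor point_mfld G u \<and> total point_mfld u \<and>
      mor G G \<iota> \<and> total G \<iota> \<and>
      ppair (pi0 G GG) (pi1 G GG \<Zsemi> m) \<Zsemi> m
        = ppair (ppair (pi0 G GG) (pi1 G GG \<Zsemi> pi0 G G) \<Zsemi> m) (pi1 G GG \<Zsemi> pi1 G G) \<Zsemi> m \<and>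
      ppair (bang G \<Zsemi> u) (ident G) \<Zsemi> m = ident G \<and>
      ppair (ident G) (bang G \<Zsemi> u) \<Zsemi> m = ident G \<and>
      ppair (ident G) \<iota> \<Zsemi> m = bang G \<Zsemi> u \<and>
      ppair \<iota> (ident G) \<Zsemi> m = bang G \<Zsemi> u)"

definition fibre_bundle ::
    "'m mfld \<Rightarrow> 'f mfld \<Rightarrow> 'e mfld \<Rightarrow> ('e \<rightharpoonup> 'm) \<Rightarrow>
     'i set \<Rightarrow> ('i \<Rightarrow> 'e \<rightharpoonup> 'm \<times> 'f) \<Rightarrow> ('i \<Rightarrow> 'm \<rightharpoonup> 'm) \<Rightarrow> bool" where
  "fibre_bundle M F E q I \<alpha> e \<longleftrightarrow>
     smooth_manifold M \<and> smooth_manifold F \<and> smooth_manifold E \<and>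
     mor E M q \<and> total E q \<and>
     (\<forall>i\<in>I. partial_iso E (prod_mfld M F) (\<alpha> i) \<and> \<alpha> i \<Zsemi> pi0 M F = rst (\<alpha> i) \<Zsemi> q) \<and>
     pjoin I (\<lambda>i. rst (\<alpha> i)) = ident E \<and>
     (\<forall>i\<in>I. restriction_idempotent M (e i) \<and>
             rst (pinv E (prod_mfld M F) (\<alpha> i)) = pprod M F (e i) (ident F))"

definition totally_fibred ::
    "('e \<rightharpoonup> 'm) \<Rightarrow> 'i set \<Rightarrow> ('i \<Rightarrow> 'e \<rightharpoonup> 'm \<times> 'f) \<Rightarrow> ('i \<Rightarrow> 'm \<rightharpoonup> 'm) \<Rightarrow> bool" where
  "totally_fibred q I \<alpha> e \<longleftrightarrow> (\<forall>i\<in>I. rst (\<alpha> i) = rst (q \<Zsemi> e i))"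

definition G_atlas :: "'g group_obj \<Rightarrow> 'm mfld \<Rightarrow> 'i set \<Rightarrow> ('i \<Rightarrow> 'i \<Rightarrow> 'm \<rightharpoonup> 'g) \<Rightarrow> bool" where
  "G_atlas K M I \<tau> \<longleftrightarrow>
     (\<forall>i\<in>I. \<forall>j\<in>I. mor M (gobj K) (\<tau> i j)) \<and>
     (\<forall>i\<in>I. \<forall>j\<in>I. \<forall>k\<in>I. ppair (\<tau> i j) (\<tau> j k) \<Zsemi> gmul K \<sqsubseteq>\<^sub>r \<tau> i k) \<and>
     (\<forall>i\<in>I. \<tau> i i \<sqsubseteq>\<^sub>r bang M \<Zsemi> gunit K) \<and>
     (\<forall>i\<in>I. \<forall>j\<in>I. \<tau> j i = \<tau> i j \<Zsemi> ginv K)"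

record ('e, 'm, 'g, 'i) par_bundle =
  par_tot :: "'e mfld"
  par_proj :: "'e \<rightharpoonup> 'm"
  par_index :: "'i set"
  par_triv :: "'i \<Rightarrow> 'e \<rightharpoonup> 'm \<times> 'g"
  par_idem :: "'i \<Rightarrow> 'm \<rightharpoonup> 'm"
  par_trans :: "'i \<Rightarrow> 'i \<Rightarrow> 'm \<rightharpoonup> 'g"

text \<open>The conditions with \<^const>\<open>extensional\<close>, here and for classical bundles, only make two families
  equal when they agree on the index set, and two functions when they agree on their domain.
  Composition being diagrammatic, the arrow \<open>\<alpha>\<^sub>i\<^sup>* \<Zsemi> \<alpha>\<^sub>j\<close> below is \<open>\<alpha>\<^sub>j \<circ> \<alpha>\<^sub>i\<^sup>-\<^sup>1\<close>, hence involves
  \<open>\<tau>\<^sub>j\<^sub>i\<close> and not \<open>\<tau>\<^sub>i\<^sub>j\<close>.\<close>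

definition principal_bundle ::
    "'g group_obj \<Rightarrow> 'm mfld \<Rightarrow> ('e, 'm, 'g, 'i) par_bundle \<Rightarrow> bool" where
  "principal_bundle K M P \<longleftrightarrow>
    (let G = gobj K; E = par_tot P; I = par_index P; \<alpha> = par_triv P; \<tau> = par_trans P in
      group_object K \<and>
      fibre_bundle M G E (par_proj P) I \<alpha> (par_idem P) \<and>
      G_atlas K M I \<tau> \<and>
      (\<forall>i\<in>I. \<forall>j\<in>I. pinv E (prod_mfld M G) (\<alpha> i) \<Zsemi> \<alpha> j
         = ppair (pi0 M G) (ppair (pi0 M G \<Zsemi> \<tau> j i) (pi1 M G) \<Zsemi> gmul K)) \<and>
      \<alpha> \<in> extensional I \<and> par_idem P \<in> extensional I \<and>
      \<tau> \<in> extensional I \<and> (\<forall>i\<in>I. \<tau> i \<in> extensional I))"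

definition par_totally_fibred :: "('e, 'm, 'g, 'i) par_bundle \<Rightarrow> bool" where
  "par_totally_fibred P \<longleftrightarrow> totally_fibred (par_proj P) (par_index P) (par_triv P) (par_idem P)"

definition par_surjective :: "'m mfld \<Rightarrow> ('e, 'm, 'g, 'i) par_bundle \<Rightarrow> bool" where
  "par_surjective M P \<longleftrightarrow> ran (par_proj P) = pts M"


section \<open>Lie groups and classical bundles\<close>

record 'g lie_group = "'g monoid" +
  lie_mfld :: "'g mfld"

definition Lie_group :: "'g lie_group \<Rightarrow> bool" where
  "Lie_group G \<longleftrightarrow>
     group G \<and> smooth_manifold (lie_mfld G) \<and> carrier G = pts (lie_mfld G) \<and>
     smooth_map (prod_mfld (lie_mfld G) (lie_mfld G)) (lie_mfld G) (\<lambda>(x, y). x \<otimes>\<^bsub>G\<^esub> y) \<and>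
     smooth_map (lie_mfld G) (lie_mfld G) (\<lambda>x. inv\<^bsub>G\<^esub> x)"

definition lie_group_obj :: "'g lie_group \<Rightarrow> 'g group_obj" where
  "lie_group_obj G =
     \<lparr>gobj = lie_mfld G,
      gmul = pmap (carrier G \<times> carrier G) (\<lambda>(x, y). x \<otimes>\<^bsub>G\<^esub> y),
      gunit = pmap UNIV (\<lambda>_. \<one>\<^bsub>G\<^esub>),
      ginv = pmap (carrier G) (\<lambda>x. inv\<^bsub>G\<^esub> x)\<rparr>"

definition smooth_left_action :: "'g lie_group \<Rightarrow> 'f mfld \<Rightarrow> ('g \<Rightarrow> 'f \<Rightarrow> 'f) \<Rightarrow> bool" where
  "smooth_left_action G F a \<longleftrightarrow>
     smooth_map (prod_mfld (lie_mfld G) F) F (\<lambda>(g, f). a g f) \<and>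
     (\<forall>f\<in>pts F. a \<one>\<^bsub>G\<^esub> f = f) \<and>
     (\<forall>g\<in>carrier G. \<forall>h\<in>carrier G. \<forall>f\<in>pts F. a (g \<otimes>\<^bsub>G\<^esub> h) f = a g (a h f))"

definition preim :: "'e mfld \<Rightarrow> ('e \<Rightarrow> 'm) \<Rightarrow> 'm set \<Rightarrow> 'e set" where
  "preim E q U = {x \<in> pts E. q x \<in> U}"

definition local_trivialization ::
    "'e mfld \<Rightarrow> ('e \<Rightarrow> 'm) \<Rightarrow> 'm mfld \<Rightarrow> 'f mfld \<Rightarrow> 'm set \<Rightarrow> ('e \<Rightarrow> 'm \<times> 'f) \<Rightarrow> bool" where
  "local_trivialization E q M F U \<alpha> \<longleftrightarrow>
     openin (mtop M) U \<and>
     diffeo (open_submfld E (preim E q U)) (prod_mfld (open_submfld M U) F) \<alpha> \<and>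
     (\<forall>x\<in>preim E q U. fst (\<alpha> x) = q x)"

definition classical_fibre_bundle :: "'e mfld \<Rightarrow> ('e \<Rightarrow> 'm) \<Rightarrow> 'm mfld \<Rightarrow> 'f mfld \<Rightarrow> bool" where
  "classical_fibre_bundle E q M F \<longleftrightarrow>
     smooth_manifold E \<and> smooth_manifold M \<and> smooth_manifold F \<and> smooth_map E M q \<and>
     (\<forall>x\<in>pts M. \<exists>U \<alpha>. x \<in> U \<and> local_trivialization E q M F U \<alpha>)"

definition fibre_bundle_atlas ::
    "'e mfld \<Rightarrow> ('e \<Rightarrow> 'm) \<Rightarrow> 'm mfld \<Rightarrow> 'f mfld \<Rightarrow>
     'i set \<Rightarrow> ('i \<Rightarrow> 'm set) \<Rightarrow> ('i \<Rightarrow> 'e \<Rightarrow> 'm \<times> 'f) \<Rightarrow> bool" where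
  "fibre_bundle_atlas E q M F I U \<alpha> \<longleftrightarrow>
     (\<Union>i\<in>I. U i) = pts M \<and> (\<forall>i\<in>I. local_trivialization E q M F (U i) (\<alpha> i))"

record ('e, 'm, 'f, 'g, 'i) cl_bundle =
  cl_tot :: "'e mfld"
  cl_proj :: "'e \<Rightarrow> 'm"
  cl_index :: "'i set"
  cl_cover :: "'i \<Rightarrow> 'm set"
  cl_triv :: "'i \<Rightarrow> 'e \<Rightarrow> 'm \<times> 'f"
  cl_trans :: "'i \<Rightarrow> 'i \<Rightarrow> 'm \<Rightarrow> 'g"

definition classical_G_bundle ::
    "'g lie_group \<Rightarrow> 'f mfld \<Rightarrow> ('g \<Rightarrow> 'f \<Rightarrow> 'f) \<Rightarrow> 'm mfld \<Rightarrow>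
     ('e, 'm, 'f, 'g, 'i) cl_bundle \<Rightarrow> bool" where
  "classical_G_bundle G F a M B \<longleftrightarrow>
    (let E = cl_tot B; q = cl_proj B; I = cl_index B; U = cl_cover B;
         \<alpha> = cl_triv B; \<tau> = cl_trans B in
      Lie_group G \<and> smooth_left_action G F a \<and>
      classical_fibre_bundle E q M F \<and>
      fibre_bundle_atlas E q M F I U \<alpha> \<and>
      (\<forall>i\<in>I. \<forall>j\<in>I. smooth_map (open_submfld M (U i \<inter> U j)) (lie_mfld G) (\<tau> i j)) \<and>
      (\<forall>i\<in>I. \<forall>j\<in>I. \<forall>k\<in>I. \<forall>x \<in> U i \<inter> U j \<inter> U k. \<tau> i j x \<otimes>\<^bsub>G\<^esub> \<tau> j k x = \<tau> i k x) \<and>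
      (\<forall>i\<in>I. \<forall>x \<in> U i. \<tau> i i x = \<one>\<^bsub>G\<^esub>) \<and>
      (\<forall>i\<in>I. \<forall>j\<in>I. \<forall>x \<in> U i \<inter> U j. \<forall>f \<in> pts F.
         \<alpha> i (inv_into (preim E q (U j)) (\<alpha> j) (x, f)) = (x, a (\<tau> i j x) f)) \<and>
      q \<in> extensional (pts E) \<and> U \<in> extensional I \<and>
      \<alpha> \<in> extensional I \<and> (\<forall>i\<in>I. \<alpha> i \<in> extensional (preim E q (U i))) \<and>
      \<tau> \<in> extensional I \<and> (\<forall>i\<in>I. \<tau> i \<in> extensional I) \<and>
      (\<forall>i\<in>I. \<forall>j\<in>I. \<tau> i j \<in> extensional (U i \<inter> U j)))"

definition classical_principal_bundle ::
    "'g lie_group \<Rightarrow> 'm mfld \<Rightarrow> ('e, 'm, 'g, 'g, 'i) cl_bundle \<Rightarrow> bool" where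
  "classical_principal_bundle G M B \<longleftrightarrow>
     classical_G_bundle G (lie_mfld G) (\<lambda>g h. g \<otimes>\<^bsub>G\<^esub> h) M B"

definition as_partial :: "('e, 'm, 'g, 'g, 'i) cl_bundle \<Rightarrow> ('e, 'm, 'g, 'i) par_bundle" where
  "as_partial B =
    (let E = cl_tot B; q = cl_proj B; I = cl_index B; U = cl_cover B in
      \<lparr>par_tot = E,
       par_proj = pmap (pts E) q,
       par_index = I,
       par_triv = (\<lambda>i\<in>I. pmap (preim E q (U i)) (cl_triv B i)),
       par_idem = (\<lambda>i\<in>I. pmap (U i) (\<lambda>x. x)),
       par_trans = (\<lambda>i\<in>I. \<lambda>j\<in>I. pmap (U i \<inter> U j) (cl_trans B i j))\<rparr>)"

end

theory Submission
  imports Defs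
begin

text \<open>A classical bundle and a bundle in the category of partial maps record the same data, once as
  functions together with the sets on which they are considered, once as partial functions.  So the
  dictionary \<^const>\<open>as_partial\<close> should be inverted by reading off the domains: the open set
  \<open>U\<^sub>i\<close> is the domain of the idempotent \<open>e\<^sub>i\<close>.  Three things have to be verified.

  The inverse dictionary must give back the bundle it started from.  This is where the domains of the
  arrows matter (\<open>principal_bundle_domains\<close>): that the bundle is totally fibred says that the domain
  of \<open>\<alpha>\<^sub>i\<close> is all of \<open>q\<^sup>-\<^sup>1(U\<^sub>i)\<close>, and comparing the domains of the two sides of the transition equation
  gives that the domain of \<open>\<tau>\<^sub>i\<^sub>j\<close> is \<open>U\<^sub>i \<inter> U\<^sub>j\<close>, because a group is not empty.

  Both sets of axioms must say the same about the common data
  (\<open>classical_principal_bundle_iff\<close>, \<open>as_partial_iff\<close>).  Composites of partial maps with known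
  domains are computed explicitly.  A diffeomorphism \<open>q\<^sup>-\<^sup>1(U\<^sub>i) \<cong> U\<^sub>i \<times> G\<close> is a partial isomorphism whose partial
  inverse has domain \<open>U\<^sub>i \<times> G\<close>; the equation \<open>\<tau>\<^sub>j\<^sub>i = \<tau>\<^sub>i\<^sub>j\<iota>\<close> is a consequence of the two
  classical cocycle conditions; and the join axiom says that the sets \<open>q\<^sup>-\<^sup>1(U\<^sub>i)\<close> cover \<open>E\<close>, which
  for surjective \<open>q\<close> means that the \<open>U\<^sub>i\<close> cover \<open>M\<close>.  In the other direction a cover of \<open>M\<close> by
  trivializing sets makes \<open>q\<close> surjective, the fibre \<open>G\<close> being inhabited.

  Smoothness of a partial map must be independent of the values of a representing function outside
  the domain, and smoothness on or into an open piece of a manifold must agree with smoothness for the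
  manifold itself.  Derivatives being local, the first holds as soon as charts have
  open images (\<open>smooth_map_cong\<close>), and this has to be known for products as well
  (\<open>charted_prod_mfld\<close>); the second holds because the charts of an open piece are restricted charts, also for products
  (\<open>smooth_map_into_open_submfld\<close>, \<open>prod_mfld_open_submfld\<close>).\<close>

section \<open>Locality of smoothness\<close>

lemma eventually_fun_upd_in_open:
  assumes S: "openin (Euclidean_space n) S" and x: "x \<in> S" and i: "i < n"
  shows "\<forall>\<^sub>F t in nhds (x i). x(i := t) \<in> S"
proof -
  have sub: "S \<subseteq> topspace (Euclidean_space n)"
    by (rule openin_subset[OF S])
  have "continuous_map euclideanreal (powertop_real UNIV) (\<lambda>t. x(i := t))"
    by (auto simp: continuous_map_componentwise_UNIV fun_upd_def)
  then have "continuous_map euclideanreal (Euclidean_space n) (\<lambda>t. x(i := t))"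
    using sub x i by (auto simp: Euclidean_space_def continuous_map_in_subtopology)
  from openin_continuous_map_preimage[OF this S]
  have "open {t. x(i := t) \<in> S}" by simp
  with x show ?thesis
    by (auto intro: eventually_nhds_in_open[THEN eventually_mono])
qed

lemma continuous_map_cong:
  assumes "\<And>x. x \<in> topspace X \<Longrightarrow> f x = g x"
  shows "continuous_map X Y f \<longleftrightarrow> continuous_map X Y g"
  using assms continuous_map_eq[of X Y f g] continuous_map_eq[of X Y g f] by auto

text \<open>By induction on the order: on an open set the two functions agree near every point, also along each
  coordinate line, hence so do their partial derivatives.\<close>

lemma Ck_cong:
  assumes "openin (Euclidean_space n) S" and "\<And>x. x \<in> S \<Longrightarrow> f x = g x"
  shows "Ck k n S f \<longleftrightarrow> Ck k n S g"
  using assms(2)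
proof (induction k arbitrary: f g)
  case (0 f g)
  show ?case unfolding Ck.simps by (rule continuous_map_cong) (simp add: 0)
next
  case (Suc k f g)
  have ev: "\<forall>\<^sub>F t in nhds (x i). f (x(i := t)) = g (x(i := t))" if "x \<in> S" "i < n" for x i
    using eventually_fun_upd_in_open[OF assms(1) that] by eventually_elim (rule Suc.prems)
  have "partial_deriv i f x = partial_deriv i g x" if "x \<in> S" "i < n" for x i
    unfolding partial_deriv_def by (rule deriv_cong_ev[OF ev[OF that] refl])
  then have pd: "Ck k n S (partial_deriv i f) \<longleftrightarrow> Ck k n S (partial_deriv i g)" if "i < n" for i
    using that by (intro Suc.IH) simp
  have "((\<lambda>t. f (x(i := t))) has_real_derivative D) (at (x i)) \<longleftrightarrow>
      ((\<lambda>t. g (x(i := t))) has_real_derivative D) (at (x i))" if "x \<in> S" "i < n" for x i D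
    by (rule DERIV_cong_ev[OF refl ev[OF that] refl])
  then have df: "(\<lambda>t. f (x(i := t))) differentiable at (x i) \<longleftrightarrow>
      (\<lambda>t. g (x(i := t))) differentiable at (x i)" if "x \<in> S" "i < n" for x i
    unfolding real_differentiable_def using that by simp
  have "continuous_map (subtopology (Euclidean_space n) S) euclideanreal f \<longleftrightarrow>
      continuous_map (subtopology (Euclidean_space n) S) euclideanreal g"
    by (rule continuous_map_cong) (simp add: Suc.prems)
  then show ?case
    unfolding Ck.simps using pd df by blast
qed

lemma Ck_mono: "Ck k n S f \<Longrightarrow> T \<subseteq> S \<Longrightarrow> Ck k n T f"
proof (induction k arbitrary: f)
  case 0
  then show ?case by (auto intro: continuous_map_from_subtopology_mono)
next
  case (Suc k)
  then show ?case by (auto intro: continuous_map_from_subtopology_mono)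
qed

lemma smooth_on_Euclidean_cong:
  assumes "openin (Euclidean_space n) S" and "\<And>x. x \<in> S \<Longrightarrow> f x = g x"
  shows "smooth_on_Euclidean n m S f \<longleftrightarrow> smooth_on_Euclidean n m S g"
  unfolding smooth_on_Euclidean_def
  using Ck_cong[OF assms(1), of "\<lambda>x. f x _" "\<lambda>x. g x _"] assms(2) by auto

lemma smooth_on_Euclidean_mono:
  "smooth_on_Euclidean n m S f \<Longrightarrow> T \<subseteq> S \<Longrightarrow> smooth_on_Euclidean n m T f"
  unfolding smooth_on_Euclidean_def using Ck_mono by blast

section \<open>Charts\<close>

text \<open>This isolates what makes smoothness a local notion.  It passes to open pieces and products by
  elementary topology, without any differentiation.\<close>

definition charted :: "'a mfld \<Rightarrow> bool" where
  "charted A \<longleftrightarrow> (\<forall>(U, \<phi>) \<in> charts A. is_chart (mtop A) (mdim A) U \<phi>)"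

lemma smooth_manifold_charted: "smooth_manifold A \<Longrightarrow> charted A"
  by (simp add: smooth_manifold_def charted_def)

lemma charted_subset: "charted A \<Longrightarrow> (U, \<phi>) \<in> charts A \<Longrightarrow> U \<subseteq> pts A"
  by (fastforce simp: charted_def is_chart_def dest: openin_subset)

lemma charted_openin: "charted A \<Longrightarrow> (U, \<phi>) \<in> charts A \<Longrightarrow> openin (mtop A) U"
  by (fastforce simp: charted_def is_chart_def)

lemma is_chart_inj_on: "is_chart X n U \<phi> \<Longrightarrow> inj_on \<phi> U"
  by (auto simp: is_chart_def homeomorphic_map_def quotient_map_def Int_absorb1 dest: openin_subset
      elim!: inj_on_subset)

text \<open>An open subset of the chart domain is open in the image of the chart, which is itself open in
  Euclidean space.\<close>

lemma is_chart_image_open: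
  assumes c: "is_chart X n U \<phi>" and W: "openin X W" "W \<subseteq> U"
  shows "openin (Euclidean_space n) (\<phi> ` W)"
proof -
  have "openin (subtopology X U) W" using W by (simp add: subset_openin_subtopology)
  moreover have "homeomorphic_map (subtopology X U) (subtopology (Euclidean_space n) (\<phi> ` U)) \<phi>"
    using c by (simp add: is_chart_def)
  ultimately have "openin (subtopology (Euclidean_space n) (\<phi> ` U)) (\<phi> ` W)"
    using homeomorphic_map_openness_eq by blast
  then show ?thesis
    using c by (auto simp: is_chart_def intro: openin_trans_full)
qed

lemma is_chart_restrict:
  assumes c: "is_chart X n U \<phi>" and S: "openin X S"
  shows "is_chart (subtopology X S) n (U \<inter> S) \<phi>"
proof -
  have U: "openin X U" using c by (simp add: is_chart_def)
  have "homeomorphic_map (subtopology X U) (subtopology (Euclidean_space n) (\<phi> ` U)) \<phi>"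
    using c by (simp add: is_chart_def)
  then have "homeomorphic_map (subtopology (subtopology X U) (U \<inter> S))
      (subtopology (subtopology (Euclidean_space n) (\<phi> ` U)) (\<phi> ` (U \<inter> S))) \<phi>"
  proof (rule homeomorphic_map_subtopologies)
    have "U \<subseteq> topspace X" "\<phi> ` U \<subseteq> topspace (Euclidean_space n)"
      using c by (auto simp: is_chart_def dest!: openin_subset)
    then show "\<phi> ` (topspace (subtopology X U) \<inter> (U \<inter> S)) =
        topspace (subtopology (Euclidean_space n) (\<phi> ` U)) \<inter> \<phi> ` (U \<inter> S)" by auto
  qed
  moreover have "U \<inter> (U \<inter> S) = S \<inter> (U \<inter> S)" "\<phi> ` U \<inter> \<phi> ` (U \<inter> S) = \<phi> ` (U \<inter> S)" by auto
  ultimately have "homeomorphic_map (subtopology (subtopology X S) (U \<inter> S))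
      (subtopology (Euclidean_space n) (\<phi> ` (U \<inter> S))) \<phi>"
    by (simp add: subtopology_subtopology)
  then show ?thesis
    using is_chart_image_open[OF c openin_Int[OF U S]] U S
    by (simp add: is_chart_def openin_subtopology_Int)
qed

lemma charted_open_submfld:
  "charted A \<Longrightarrow> openin (mtop A) S \<Longrightarrow> charted (open_submfld A S)"
  by (fastforce simp: charted_def open_submfld_def intro: is_chart_restrict)

text \<open>This is the glueing of coordinates used in \<^const>\<open>prod_mfld\<close>; its inverse splits off the
  first \<open>n\<close> coordinates.\<close>

lemma homeomorphic_map_Euclidean_space_add:
  "homeomorphic_map (prod_topology (Euclidean_space n) (Euclidean_space m)) (Euclidean_space (n + m))
     (\<lambda>(x, y) i. if i < n then x i else y (i - n))"
proof -
  let ?E = "Euclidean_space" and ?j = "\<lambda>(x, y) i. if i < n then x i else y (i - n) :: real"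
  let ?s = "\<lambda>z. (\<lambda>i. if i < n then z i else 0 :: real, \<lambda>i. z (i + n))"
  have coord: "continuous_map (?E k) euclideanreal (\<lambda>z. z i)" for k i
    unfolding Euclidean_space_def
    by (intro continuous_map_from_subtopology continuous_map_product_projection) auto
  have c1: "continuous_map (prod_topology (?E n) (?E m)) euclideanreal (\<lambda>p. fst p i)"
    and c2: "continuous_map (prod_topology (?E n) (?E m)) euclideanreal (\<lambda>p. snd p i)" for i
    using continuous_map_compose[OF continuous_map_fst coord]
      continuous_map_compose[OF continuous_map_snd coord] by (simp_all add: o_def)
  have "homeomorphic_maps (prod_topology (?E n) (?E m)) (?E (n + m)) ?j ?s"
    unfolding homeomorphic_maps_def
  proof (intro conjI)
    have "continuous_map (prod_topology (?E n) (?E m)) euclideanreal (\<lambda>p. ?j p i)" for i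
      by (cases "i < n") (simp_all add: case_prod_unfold c1 c2)
    then show "continuous_map (prod_topology (?E n) (?E m)) (?E (n + m)) ?j"
      by (auto simp: Euclidean_space_def continuous_map_in_subtopology continuous_map_componentwise_UNIV)
    have "continuous_map (?E (n + m)) euclideanreal (\<lambda>z. if i < n then z i else 0)" for i
      by (cases "i < n") (simp_all add: coord)
    then show "continuous_map (?E (n + m)) (prod_topology (?E n) (?E m)) ?s"
      using coord
      by (auto simp: continuous_map_paired Euclidean_space_def continuous_map_in_subtopology
          continuous_map_componentwise_UNIV)
  qed (auto simp: topspace_Euclidean_space fun_eq_iff)
  then show ?thesis by (auto simp: homeomorphic_map_maps)
qed

text \<open>A product chart is the product of two homeomorphisms, followed by the glueing of coordinates.\<close>

lemma charted_prod_mfld: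
  assumes A: "charted A" and B: "charted B"
  shows "charted (prod_mfld A B)"
proof -
  let ?E = "Euclidean_space" and ?n = "mdim A" and ?m = "mdim B"
  let ?j = "\<lambda>(x, y) i. if i < ?n then x i else y (i - ?n) :: real"
  have "is_chart (prod_topology (mtop A) (mtop B)) (?n + ?m) (U \<times> V)
          (\<lambda>(x, y) i. if i < ?n then \<phi> x i else \<psi> y (i - ?n))"
    if "(U, \<phi>) \<in> charts A" "(V, \<psi>) \<in> charts B" for U V \<phi> \<psi>
  proof -
    have \<phi>: "is_chart (mtop A) ?n U \<phi>" and \<psi>: "is_chart (mtop B) ?m V \<psi>"
      using that A B by (auto simp: charted_def)
    let ?P = "\<phi> ` U \<times> \<psi> ` V" and ?c = "\<lambda>(x, y) i. if i < ?n then \<phi> x i else \<psi> y (i - ?n)"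
    have im: "?c ` (U \<times> V) = ?j ` ?P" by (force simp: image_iff)
    have oP: "openin (prod_topology (?E ?n) (?E ?m)) ?P"
      using \<phi> \<psi> by (auto simp: is_chart_def openin_prod_Times_iff)
    note P = openin_subset[OF oP]
    have img: "?j ` topspace (prod_topology (?E ?n) (?E ?m)) = topspace (?E (?n + ?m))"
      using homeomorphic_imp_surjective_map[OF homeomorphic_map_Euclidean_space_add] .
    have "homeomorphic_map (subtopology (mtop A) U) (subtopology (?E ?n) (\<phi> ` U)) \<phi>"
      and "homeomorphic_map (subtopology (mtop B) V) (subtopology (?E ?m) (\<psi> ` V)) \<psi>"
      using \<phi> \<psi> by (auto simp: is_chart_def)
    then obtain f g where
      "homeomorphic_maps (subtopology (mtop A) U) (subtopology (?E ?n) (\<phi> ` U)) \<phi> f"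
      "homeomorphic_maps (subtopology (mtop B) V) (subtopology (?E ?m) (\<psi> ` V)) \<psi> g"
      by (auto simp: homeomorphic_map_maps)
    then have "homeomorphic_maps (subtopology (prod_topology (mtop A) (mtop B)) (U \<times> V))
        (subtopology (prod_topology (?E ?n) (?E ?m)) ?P) (\<lambda>(x, y). (\<phi> x, \<psi> y)) (\<lambda>(x, y). (f x, g y))"
      by (auto simp only: subtopology_Times homeomorphic_maps_prod)
    then have "homeomorphic_map (subtopology (prod_topology (mtop A) (mtop B)) (U \<times> V))
        (subtopology (prod_topology (?E ?n) (?E ?m)) ?P) (\<lambda>(x, y). (\<phi> x, \<psi> y))"
      by (auto simp: homeomorphic_map_maps)
    moreover have "homeomorphic_map (subtopology (prod_topology (?E ?n) (?E ?m)) ?P)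
        (subtopology (?E (?n + ?m)) (?j ` ?P)) ?j"
      by (rule homeomorphic_map_subtopologies[OF homeomorphic_map_Euclidean_space_add])
        (use P img in blast)
    ultimately have "homeomorphic_map (subtopology (prod_topology (mtop A) (mtop B)) (U \<times> V))
        (subtopology (?E (?n + ?m)) (?j ` ?P)) (?j \<circ> (\<lambda>(x, y). (\<phi> x, \<psi> y)))"
      by (rule homeomorphic_map_compose)
    moreover have "?j \<circ> (\<lambda>(x, y). (\<phi> x, \<psi> y)) = ?c" by (auto simp: fun_eq_iff)
    moreover have "openin (?E (?n + ?m)) (?j ` ?P)"
      using oP P homeomorphic_map_openness[OF homeomorphic_map_Euclidean_space_add] by blast
    ultimately show ?thesis
      using \<phi> \<psi> im by (auto simp: is_chart_def openin_prod_Times_iff)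
  qed
  then show ?thesis by (auto simp: charted_def prod_mfld_def)
qed

section \<open>Smooth maps\<close>

lemma ball_pairI: "(\<And>x y. (x, y) \<in> S \<Longrightarrow> P x y) \<Longrightarrow> \<forall>(x, y) \<in> S. P x y"
  by blast

text \<open>In charts the two maps coincide on a set that is open by continuity, and
  \<^const>\<open>smooth_on_Euclidean\<close> only depends on the values there.  This allows passing
  between a partial map and any total function that represents it, in particular between a
  partial inverse and \<^const>\<open>inv_into\<close>.\<close>

lemma smooth_map_cong:
  assumes A: "charted A" and B: "charted B" and eq: "\<And>x. x \<in> pts A \<Longrightarrow> f x = g x"
  shows "smooth_map A B f \<longleftrightarrow> smooth_map A B g"
proof -
  have "smooth_map A B g" if f: "smooth_map A B f" and eq: "\<And>x. x \<in> pts A \<Longrightarrow> f x = g x" for f g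
    unfolding smooth_map_def
  proof (intro conjI ball_pairI)
    show "continuous_map (mtop A) (mtop B) g"
      using f continuous_map_cong[of "mtop A" f g] eq by (simp add: smooth_map_def)
    fix U \<phi> V \<psi> assume U: "(U, \<phi>) \<in> charts A" and V: "(V, \<psi>) \<in> charts B"
    have c: "is_chart (mtop A) (mdim A) U \<phi>" using U A by (auto simp: charted_def)
    have sub: "U \<subseteq> pts A" by (rule charted_subset[OF A U])
    let ?W = "{x \<in> U. f x \<in> V}"
    have W: "?W = {x \<in> U. g x \<in> V}" using eq sub by auto
    have "openin (mtop A) {x \<in> pts A. f x \<in> V}"
      using f charted_openin[OF B V] by (auto simp: smooth_map_def intro: openin_continuous_map_preimage)
    then have "openin (mtop A) (U \<inter> {x \<in> pts A. f x \<in> V})"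
      using charted_openin[OF A U] by blast
    moreover have "U \<inter> {x \<in> pts A. f x \<in> V} = ?W" using sub by auto
    ultimately have "openin (Euclidean_space (mdim A)) (\<phi> ` ?W)"
      by (intro is_chart_image_open[OF c]) auto
    moreover have "smooth_on_Euclidean (mdim A) (mdim B) (\<phi> ` ?W) (\<psi> \<circ> f \<circ> inv_into U \<phi>)"
      using f U V unfolding smooth_map_def by blast
    moreover have "(\<psi> \<circ> f \<circ> inv_into U \<phi>) y = (\<psi> \<circ> g \<circ> inv_into U \<phi>) y" if "y \<in> \<phi> ` ?W" for y
    proof -
      have "inv_into U \<phi> y \<in> U" using that by (auto intro: inv_into_into)
      then show ?thesis using eq sub by auto
    qed
    ultimately show "smooth_on_Euclidean (mdim A) (mdim B) (\<phi> ` {x \<in> U. g x \<in> V})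
        (\<psi> \<circ> g \<circ> inv_into U \<phi>)"
      unfolding W by (subst smooth_on_Euclidean_cong[where g = "\<psi> \<circ> f \<circ> inv_into U \<phi>"]) simp_all
  qed
  from this[of f g] this[of g f] eq show ?thesis by auto
qed

lemma open_submfld_simps [simp]:
  "mtop (open_submfld A S) = subtopology (mtop A) S" "mdim (open_submfld A S) = mdim A"
  by (simp_all add: open_submfld_def)

lemma prod_mfld_simps [simp]:
  "mtop (prod_mfld A B) = prod_topology (mtop A) (mtop B)"
  "mdim (prod_mfld A B) = mdim A + mdim B"
  by (simp_all add: prod_mfld_def)

lemma charts_open_submfld: "charts (open_submfld A S) = (\<lambda>(U, \<phi>). (U \<inter> S, \<phi>)) ` charts A"
  by (auto simp: open_submfld_def image_iff)

lemma charts_prod_mfld: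
  "charts (prod_mfld A B) = (\<lambda>((U, \<phi>), (V, \<psi>)).
     (U \<times> V, \<lambda>(x, y) i. if i < mdim A then \<phi> x i else \<psi> y (i - mdim A))) ` (charts A \<times> charts B)"
  by (force simp: prod_mfld_def image_iff)

lemma open_submfld_pts: "charted A \<Longrightarrow> open_submfld A (pts A) = A"
proof -
  assume A: "charted A"
  have "{(U \<inter> pts A, \<phi>) |U \<phi>. (U, \<phi>) \<in> charts A} = charts A"
    using charted_subset[OF A] by (force simp: Int_absorb2)
  then show ?thesis by (simp add: open_submfld_def)
qed

text \<open>Cutting down the first factor before or after forming the product gives literally the same manifold,
  with the same charts: the domains of the charts of \<open>F\<close> lie in \<open>F\<close>, so intersecting with
  \<^term>\<open>U \<times> pts F\<close> only affects the first factor.\<close>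

lemma prod_mfld_open_submfld:
  assumes "charted F"
  shows "prod_mfld (open_submfld M U) F = open_submfld (prod_mfld M F) (U \<times> pts F)"
proof -
  let ?cut = "\<lambda>S (V, \<phi>). (V \<inter> S, \<phi>)"
    and ?times = "\<lambda>((V, \<phi>), (W, \<psi>)). (V \<times> W, \<lambda>(x, y) i. if i < mdim M then \<phi> x i else \<psi> y (i - mdim M))"
  have "?times (?cut U (fst p), snd p) = ?cut (U \<times> pts F) (?times p)" if "p \<in> charts M \<times> charts F" for p
    using charted_subset[OF assms, of "fst (snd p)" "snd (snd p)"] that
    by (cases p) (auto simp: Int_absorb2)
  then have "(\<lambda>p. ?times (?cut U (fst p), snd p)) ` (charts M \<times> charts F)
      = (\<lambda>p. ?cut (U \<times> pts F) (?times p)) ` (charts M \<times> charts F)"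
    by (rule image_cong[OF refl])
  moreover have "(?cut U ` charts M) \<times> charts F = (\<lambda>p. (?cut U (fst p), snd p)) ` (charts M \<times> charts F)"
    by force
  ultimately have "charts (prod_mfld (open_submfld M U) F) = charts (open_submfld (prod_mfld M F) (U \<times> pts F))"
    by (simp add: charts_prod_mfld charts_open_submfld image_image case_prod_unfold cong: if_cong)
  then show ?thesis
    by (simp add: prod_mfld_def open_submfld_def prod_topology_subtopology)
qed

text \<open>Shrinking the target does not change the chart maps, and for a map with values in \<open>S\<close> the points sent into
  \<^term>\<open>V \<inter> S\<close> are those sent into \<open>V\<close>.\<close>

lemma smooth_map_into_open_submfld:
  assumes A: "charted A"
  shows "smooth_map A (open_submfld B S) f \<longleftrightarrow> smooth_map A B f \<and> f \<in> pts A \<rightarrow> S"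
proof -
  have "smooth_map A (open_submfld B S) f \<longleftrightarrow> smooth_map A B f" if S: "f \<in> pts A \<rightarrow> S"
  proof -
    have "{x \<in> fst c. f x \<in> V \<and> f x \<in> S} = {x \<in> fst c. f x \<in> V}" if "c \<in> charts A" for c V
      using charted_subset[OF A, of "fst c" "snd c"] that S by auto
    then show ?thesis
      using S
      by (auto simp: smooth_map_def continuous_map_in_subtopology charts_open_submfld
          case_prod_unfold cong: ball_cong)
  qed
  moreover have "f \<in> pts A \<rightarrow> S" if "smooth_map A (open_submfld B S) f"
    using that by (auto simp: smooth_map_def continuous_map_in_subtopology)
  ultimately show ?thesis by auto
qed

lemma smooth_manifold_transition:
  assumes "smooth_manifold A" and "(U, \<phi>) \<in> charts A" and "(V, \<psi>) \<in> charts A"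
  shows "smooth_on_Euclidean (mdim A) (mdim A) (\<phi> ` (U \<inter> V)) (\<psi> \<circ> inv_into U \<phi>)"
  using assms by (auto simp: smooth_manifold_def)

text \<open>In charts the inclusion is a restriction of a coordinate change.\<close>

lemma smooth_map_inclusion:
  assumes A: "smooth_manifold A" and S: "openin (mtop A) S"
  shows "smooth_map (open_submfld A S) A (\<lambda>x. x)"
  unfolding smooth_map_def
proof (intro conjI ball_pairI)
  fix U \<phi> V \<psi>
  assume U: "(U, \<phi>) \<in> charts (open_submfld A S)" and V: "(V, \<psi>) \<in> charts A"
  then obtain U' where U': "(U', \<phi>) \<in> charts A" "U = U' \<inter> S" by (auto simp: open_submfld_def)
  have c: "is_chart (mtop A) (mdim A) U' \<phi>" using A U' by (auto simp: smooth_manifold_def)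
  have o: "openin (mtop A) (U' \<inter> S \<inter> V)"
    using charted_openin[OF smooth_manifold_charted[OF A]] U' V S by blast
  have eq: "{x \<in> U. x \<in> V} = U' \<inter> S \<inter> V" using U' by auto
  have "smooth_on_Euclidean (mdim A) (mdim A) (\<phi> ` (U' \<inter> V)) (\<psi> \<circ> inv_into U' \<phi>)"
    using smooth_manifold_transition[OF A U'(1) V] .
  then have sm: "smooth_on_Euclidean (mdim A) (mdim A) (\<phi> ` (U' \<inter> S \<inter> V)) (\<psi> \<circ> inv_into U' \<phi>)"
    by (rule smooth_on_Euclidean_mono) auto
  have oim: "openin (Euclidean_space (mdim A)) (\<phi> ` (U' \<inter> S \<inter> V))"
    by (rule is_chart_image_open[OF c o]) auto
  have agree: "(\<psi> \<circ> inv_into U' \<phi>) y = (\<psi> \<circ> (\<lambda>x. x) \<circ> inv_into U \<phi>) y"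
    if "y \<in> \<phi> ` (U' \<inter> S \<inter> V)" for y
  proof -
    obtain x where x: "x \<in> U' \<inter> S \<inter> V" "y = \<phi> x" using \<open>y \<in> _\<close> by blast
    have "inj_on \<phi> U'" by (rule is_chart_inj_on[OF c])
    then have "inv_into U' \<phi> y = x" "inv_into U \<phi> y = x"
      using x U'(2) by (auto intro!: inv_into_f_eq intro: inj_on_subset)
    then show ?thesis by simp
  qed
  show "smooth_on_Euclidean (mdim (open_submfld A S)) (mdim A) (\<phi> ` {x \<in> U. x \<in> V})
      (\<psi> \<circ> (\<lambda>x. x) \<circ> inv_into U \<phi>)"
    unfolding eq open_submfld_simps by (rule iffD1[OF smooth_on_Euclidean_cong[OF oim agree] sm])
qed (simp add: continuous_map_from_subtopology)

lemma charted_point_mfld: "charted point_mfld"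
proof -
  have E: "topspace (Euclidean_space 0) = {\<lambda>_. 0}"
    by (auto simp: topspace_Euclidean_space)
  then have "openin (Euclidean_space 0) {\<lambda>_. 0}" by (metis openin_topspace)
  moreover have "homeomorphic_maps (discrete_topology UNIV) (Euclidean_space 0) (\<lambda>_ _. 0) (\<lambda>_. ())"
    using E by (auto simp: homeomorphic_maps_def)
  then have "homeomorphic_map (discrete_topology UNIV) (Euclidean_space 0) (\<lambda>_::unit. \<lambda>_. 0)"
    by (auto simp: homeomorphic_map_maps)
  ultimately show ?thesis
    using subtopology_topspace[of "Euclidean_space 0"]
    by (auto simp: charted_def point_mfld_def is_chart_def E)
qed

text \<open>The model space of the point has no coordinate directions, so that smoothness is continuity.\<close>

lemma smooth_map_from_point:
  assumes "charted A" and "a \<in> pts A"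
  shows "smooth_map point_mfld A (\<lambda>_. a)"
proof -
  have "Ck k 0 S (\<lambda>x. c)" for k S c by (cases k) simp_all
  then show ?thesis
    using assms by (auto simp: smooth_map_def point_mfld_def smooth_on_Euclidean_def comp_def)
qed

section \<open>Partial maps with a given domain\<close>

text \<open>Every arrow has the form \<^term>\<open>pmap S f\<close>.  With the domains written out, the operations of the
  category become set-theoretic formulas, and an equation of arrows splits into one of
  domains and one of values.\<close>

lemma dom_pmap [simp]: "dom (pmap S f) = S"
  by (auto simp: pmap_def dom_def restrict_map_def split: if_splits)

lemma pmap_apply: "pmap S f x = (if x \<in> S then Some (f x) else None)"
  by (simp add: pmap_def)

lemma pmap_eq_iff: "pmap S f = pmap T g \<longleftrightarrow> S = T \<and> (\<forall>x\<in>S. f x = g x)"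
  by (auto simp: fun_eq_iff pmap_apply split: if_splits)

lemma pmap_dom_the: "pmap (dom f) (\<lambda>x. the (f x)) = f"
  by (auto simp: fun_eq_iff pmap_apply domIff)

lemma ran_pmap: "ran (pmap S f) = f ` S"
  by (auto simp: ran_def pmap_apply)

lemma pcomp_pmap: "pmap S f \<Zsemi> pmap T g = pmap {x \<in> S. f x \<in> T} (\<lambda>x. g (f x))"
  by (auto simp: fun_eq_iff pcomp_def map_comp_def pmap_apply)

lemma rst_pmap: "rst (pmap S f) = pmap S (\<lambda>x. x)"
  by (simp add: rst_def)

lemma ppair_pmap: "ppair (pmap S f) (pmap T g) = pmap (S \<inter> T) (\<lambda>x. (f x, g x))"
  by (auto simp: ppair_def pmap_eq_iff pmap_apply)

lemma rle_pmap: "pmap S f \<sqsubseteq>\<^sub>r pmap T g \<longleftrightarrow> S \<subseteq> T \<and> (\<forall>x\<in>S. f x = g x)"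
  by (auto simp: rle_def rst_pmap pcomp_pmap pmap_eq_iff)

lemma pjoin_identities: "pjoin I (\<lambda>i. pmap (S i) (\<lambda>x. x)) = pmap (\<Union>i\<in>I. S i) (\<lambda>x. x)"
  by (auto simp: fun_eq_iff pjoin_def pmap_apply dom_def intro!: the_equality split: if_splits)

lemmas pmap_calculus =
  pcomp_pmap rst_pmap ppair_pmap rle_pmap ident_def bang_def pi0_def pi1_def

lemma mor_pmap:
  assumes "charted A" and "charted B"
  shows "mor A B (pmap S f) \<longleftrightarrow> openin (mtop A) S \<and> smooth_map (open_submfld A S) B f"
proof -
  have "smooth_map (open_submfld A S) B (\<lambda>x. the (pmap S f x)) \<longleftrightarrow> smooth_map (open_submfld A S) B f"
    if "openin (mtop A) S"
    using assms that by (intro smooth_map_cong charted_open_submfld) (auto simp: pmap_apply)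
  then show ?thesis by (auto simp: mor_def)
qed

lemma mor_pmap_total:
  assumes "charted A" and "charted B"
  shows "mor A B (pmap (pts A) f) \<longleftrightarrow> smooth_map A B f"
  using assms by (simp add: mor_pmap open_submfld_pts)

section \<open>Partial isomorphisms and diffeomorphisms\<close>

text \<open>The two composition laws say that \<open>g\<close> is a two-sided inverse between the domains, so they force
  \<open>f\<close> to be injective and determine \<open>g\<close>; this makes \<^const>\<open>pinv\<close> computable.\<close>

lemma partial_inverse_pmap:
  "partial_inverse A B (pmap S f) g \<longleftrightarrow>
     mor A B (pmap S f) \<and> mor B A g \<and> inj_on f S \<and> g = pmap (f ` S) (inv_into S f)"
proof (cases "mor A B (pmap S f) \<and> mor B A g")
  case True
  obtain T h where g: "g = pmap T h" using pmap_dom_the by metis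
  have "pmap S f \<Zsemi> g = rst (pmap S f) \<and> g \<Zsemi> pmap S f = rst g \<longleftrightarrow>
      (\<forall>x\<in>S. f x \<in> T \<and> h (f x) = x) \<and> (\<forall>y\<in>T. h y \<in> S \<and> f (h y) = y)"
    unfolding g by (auto simp: pmap_calculus pmap_eq_iff)
  also have "\<dots> \<longleftrightarrow> inj_on f S \<and> T = f ` S \<and> (\<forall>y\<in>T. h y = inv_into S f y)" (is "?L \<longleftrightarrow> ?R")
  proof
    assume L: ?L
    then have inj: "inj_on f S" by (metis inj_onI)
    moreover have "T = f ` S" using L by force
    moreover have "h y = inv_into S f y" if "y \<in> T" for y
      using L that inj by (metis inv_into_f_f)
    ultimately show ?R by blast
  next
    assume ?R
    then show ?L by (auto simp: inv_into_into)
  qed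
  finally show ?thesis
    using True by (auto simp: partial_inverse_def g pmap_eq_iff)
qed (auto simp: partial_inverse_def)

lemma partial_iso_pmap:
  "partial_iso A B (pmap S f) \<longleftrightarrow>
     mor A B (pmap S f) \<and> inj_on f S \<and> mor B A (pmap (f ` S) (inv_into S f))"
  by (auto simp: partial_iso_def partial_inverse_pmap)

lemma pinv_pmap:
  "partial_iso A B (pmap S f) \<Longrightarrow> pinv A B (pmap S f) = pmap (f ` S) (inv_into S f)"
  unfolding pinv_def partial_iso_def partial_inverse_pmap by (rule the_equality) auto

text \<open>This is the bridge between the two notions of trivialization.\<close>

lemma diffeo_open_submfld_iff:
  assumes A: "charted A" and B: "charted B" and S: "openin (mtop A) S" and T: "openin (mtop B) T"
  shows "diffeo (open_submfld A S) (open_submfld B T) f \<longleftrightarrow>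
    partial_iso A B (pmap S f) \<and> f ` S = T"
proof -
  have pts: "pts (open_submfld A S) = S" "pts (open_submfld B T) = T"
    using S T by (auto dest: openin_subset)
  note cS = charted_open_submfld[OF A S] and cT = charted_open_submfld[OF B T]
  have "inv_into S f \<in> T \<rightarrow> S" if "f ` S = T"
    using that by (auto intro: inv_into_into)
  then show ?thesis
    unfolding diffeo_def partial_iso_pmap mor_pmap[OF A B] mor_pmap[OF B A] pts
      smooth_map_into_open_submfld[OF cS] smooth_map_into_open_submfld[OF cT] bij_betw_def
    using S T by auto
qed

section \<open>Lie groups as group objects\<close>

lemma pprod_pmap:
  "pprod A B (pmap S f) (pmap T g) =
     pmap {p \<in> pts A \<times> pts B. fst p \<in> S \<and> snd p \<in> T} (\<lambda>p. (f (fst p), g (snd p)))"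
  by (auto simp: pprod_def pmap_calculus pmap_eq_iff)

lemma gobj_lie_group_obj [simp]: "gobj (lie_group_obj G) = lie_mfld G"
  by (simp add: lie_group_obj_def)

lemma group_object_lie_group_obj:
  assumes G: "Lie_group G"
  shows "group_object (lie_group_obj G)"
proof -
  let ?L = "lie_mfld G"
  have L: "smooth_manifold ?L" and C: "carrier G = pts ?L"
    and m: "smooth_map (prod_mfld ?L ?L) ?L (\<lambda>(x, y). x \<otimes>\<^bsub>G\<^esub> y)"
    and i: "smooth_map ?L ?L (\<lambda>x. inv\<^bsub>G\<^esub> x)"
    using G by (auto simp: Lie_group_def)
  interpret group G using G by (simp add: Lie_group_def)
  have c: "charted ?L" "charted (prod_mfld ?L ?L)" "charted point_mfld"
    using smooth_manifold_charted[OF L] charted_prod_mfld charted_point_mfld by auto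
  have "mor (prod_mfld ?L ?L) ?L (pmap (carrier G \<times> carrier G) (\<lambda>(x, y). x \<otimes>\<^bsub>G\<^esub> y))"
    using m mor_pmap_total[OF c(2,1)] by (simp add: C)
  moreover have "mor ?L ?L (pmap (carrier G) (\<lambda>x. inv\<^bsub>G\<^esub> x))"
    using i mor_pmap_total[OF c(1,1)] by (simp add: C)
  moreover have "mor point_mfld ?L (pmap UNIV (\<lambda>_. \<one>\<^bsub>G\<^esub>))"
    using smooth_map_from_point[OF c(1), of "\<one>\<^bsub>G\<^esub>"] mor_pmap_total[OF c(3,1), of "\<lambda>_. \<one>\<^bsub>G\<^esub>"] one_closed
    by (simp add: C point_mfld_def)
  ultimately show ?thesis
    using L
    by (auto simp: group_object_def lie_group_obj_def Let_def total_def pmap_calculus pmap_eq_iff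
        C[symmetric] point_mfld_def m_assoc)
qed

section \<open>Local trivializations\<close>

lemma openin_preim:
  assumes "smooth_map E M q" and "openin (mtop M) U"
  shows "openin (mtop E) (preim E q U)"
  using assms unfolding smooth_map_def preim_def by (blast intro: openin_continuous_map_preimage)

lemma local_trivialization_iff:
  assumes E: "charted E" and M: "charted M" and F: "charted F"
    and q: "smooth_map E M q" and U: "openin (mtop M) U"
  shows "local_trivialization E q M F U a \<longleftrightarrow>
    partial_iso E (prod_mfld M F) (pmap (preim E q U) a) \<and>
    a ` preim E q U = U \<times> pts F \<and> (\<forall>x\<in>preim E q U. fst (a x) = q x)"
proof -
  have "openin (mtop (prod_mfld M F)) (U \<times> pts F)"
    using U by (simp add: openin_prod_Times_iff)
  then show ?thesis
    using U diffeo_open_submfld_iff[OF E charted_prod_mfld[OF M F] openin_preim[OF q U]]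
    by (auto simp: local_trivialization_def prod_mfld_open_submfld[OF F])
qed

text \<open>The axiom on the domain of the partial inverse fixes the image of the trivialization to be \<open>U \<times> F\<close>.
  Since that image lies in the product, compatibility with the projections has the same
  domain on both sides and becomes the pointwise condition.\<close>

lemma fibre_bundle_chart_iff:
  assumes U: "U \<subseteq> pts M"
  shows "partial_iso E (prod_mfld M F) (pmap (preim E q U) a) \<and>
      pmap (preim E q U) a \<Zsemi> pi0 M F = rst (pmap (preim E q U) a) \<Zsemi> pmap (pts E) q \<and>
      rst (pinv E (prod_mfld M F) (pmap (preim E q U) a)) = pprod M F (pmap U (\<lambda>x. x)) (ident F)
    \<longleftrightarrow> partial_iso E (prod_mfld M F) (pmap (preim E q U) a) \<and>
      a ` preim E q U = U \<times> pts F \<and> (\<forall>x\<in>preim E q U. fst (a x) = q x)"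
proof (cases "partial_iso E (prod_mfld M F) (pmap (preim E q U) a)")
  case True
  have "{p \<in> pts M \<times> pts F. fst p \<in> U \<and> snd p \<in> pts F} = U \<times> pts F"
    using U by auto
  then have "rst (pinv E (prod_mfld M F) (pmap (preim E q U) a)) = pprod M F (pmap U (\<lambda>x. x)) (ident F)
      \<longleftrightarrow> a ` preim E q U = U \<times> pts F"
    by (auto simp: pinv_pmap[OF True] rst_pmap ident_def pprod_pmap pmap_eq_iff)
  moreover have "pmap (preim E q U) a \<Zsemi> pi0 M F = rst (pmap (preim E q U) a) \<Zsemi> pmap (pts E) q
      \<longleftrightarrow> (\<forall>x\<in>preim E q U. fst (a x) = q x)" if im: "a ` preim E q U = U \<times> pts F"
  proof -
    have "a ` preim E q U \<subseteq> pts M \<times> pts F" using im U by auto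
    then have "{x \<in> preim E q U. a x \<in> pts M \<times> pts F} = preim E q U" by blast
    moreover have "{x \<in> preim E q U. x \<in> pts E} = preim E q U"
      by (auto simp: preim_def)
    ultimately show ?thesis by (auto simp: pmap_calculus pmap_eq_iff)
  qed
  ultimately show ?thesis by blast
qed simp

lemma restriction_idempotent_iff:
  assumes M: "smooth_manifold M"
  shows "restriction_idempotent M (pmap U (\<lambda>x. x)) \<longleftrightarrow> openin (mtop M) U"
  using smooth_map_inclusion[OF M]
    mor_pmap[OF smooth_manifold_charted[OF M] smooth_manifold_charted[OF M], of U "\<lambda>x. x"]
  by (auto simp: restriction_idempotent_def rst_pmap)

section \<open>Cocycles\<close>

definition smooth_cocycle ::
    "'g lie_group \<Rightarrow> 'm mfld \<Rightarrow> 'i set \<Rightarrow> ('i \<Rightarrow> 'm set) \<Rightarrow> ('i \<Rightarrow> 'i \<Rightarrow> 'm \<Rightarrow> 'g) \<Rightarrow> bool" where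
  "smooth_cocycle G M I U t \<longleftrightarrow>
     (\<forall>i\<in>I. \<forall>j\<in>I. smooth_map (open_submfld M (U i \<inter> U j)) (lie_mfld G) (t i j)) \<and>
     (\<forall>i\<in>I. \<forall>j\<in>I. \<forall>k\<in>I. \<forall>x \<in> U i \<inter> U j \<inter> U k. t i j x \<otimes>\<^bsub>G\<^esub> t j k x = t i k x) \<and>
     (\<forall>i\<in>I. \<forall>x \<in> U i. t i i x = \<one>\<^bsub>G\<^esub>)"

lemma smooth_cocycle_closed:
  assumes "Lie_group G" and "smooth_cocycle G M I U t" and "openin (mtop M) (U i)"
    and "i \<in> I" "j \<in> I" "x \<in> U i \<inter> U j"
  shows "t i j x \<in> carrier G"
proof -
  have "continuous_map (subtopology (mtop M) (U i \<inter> U j)) (mtop (lie_mfld G)) (t i j)"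
    using assms(2,4,5) by (auto simp: smooth_cocycle_def smooth_map_def)
  moreover have "x \<in> pts M" using assms(3,6) by (auto dest: openin_subset)
  ultimately show ?thesis
    using assms(1,6) by (auto simp: Lie_group_def continuous_map_def Pi_iff)
qed

text \<open>The inclusions of arrows hold on domains automatically, since the structure maps are total and
  \<open>U\<^sub>i \<inter> U\<^sub>j \<inter> U\<^sub>k \<subseteq> U\<^sub>i \<inter> U\<^sub>k\<close>; what remains are the pointwise cocycle conditions.  They imply the condition on
  inverses: \<open>\<tau>\<^sub>j\<^sub>i(x) \<tau>\<^sub>i\<^sub>j(x) = \<tau>\<^sub>j\<^sub>j(x) = 1\<close>.\<close>

lemma G_atlas_iff:
  assumes M: "smooth_manifold M" and G: "Lie_group G" and U: "\<And>i. i \<in> I \<Longrightarrow> openin (mtop M) (U i)"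
  shows "G_atlas (lie_group_obj G) M I (\<lambda>i\<in>I. \<lambda>j\<in>I. pmap (U i \<inter> U j) (t i j))
    \<longleftrightarrow> smooth_cocycle G M I U t"
proof -
  let ?L = "lie_mfld G" and ?K = "lie_group_obj G" and ?p = "\<lambda>i j. pmap (U i \<inter> U j) (t i j)"
  interpret group G using G by (simp add: Lie_group_def)
  have c: "charted M" "charted ?L" and C: "carrier G = pts ?L"
    using M G by (auto simp: Lie_group_def smooth_manifold_charted)
  have sub: "U i \<subseteq> pts M" if "i \<in> I" for i
    using U[OF that] by (rule openin_subset)
  have mor: "mor M ?L (?p i j) \<longleftrightarrow> smooth_map (open_submfld M (U i \<inter> U j)) ?L (t i j)"
    if "i \<in> I" "j \<in> I" for i j
    using that U by (simp add: mor_pmap[OF c] openin_Int)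
  have unit: "pmap (U i) (t i i) \<sqsubseteq>\<^sub>r bang M \<Zsemi> gunit ?K \<longleftrightarrow> (\<forall>x \<in> U i. t i i x = \<one>\<^bsub>G\<^esub>)" if "i \<in> I" for i
    using sub[OF that] by (auto simp: lie_group_obj_def pmap_calculus)
  \<comment> \<open>Both sides contain the smoothness of the transition functions.  It is settled first because
    it is the source of the fact that their values lie in the group.\<close>
  show ?thesis
  proof (cases "\<forall>i\<in>I. \<forall>j\<in>I. smooth_map (open_submfld M (U i \<inter> U j)) ?L (t i j)")
    case True
    have cl: "t i j x \<in> carrier G" if "i \<in> I" "j \<in> I" "x \<in> U i \<inter> U j" for i j x
    proof -
      have "continuous_map (subtopology (mtop M) (U i \<inter> U j)) (mtop ?L) (t i j)"
        using True that by (simp add: smooth_map_def)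
      then show ?thesis
        using that sub by (auto simp: C continuous_map_def Pi_iff subset_iff)
    qed
    have mult: "ppair (?p i j) (?p j k) \<Zsemi> gmul ?K \<sqsubseteq>\<^sub>r ?p i k
        \<longleftrightarrow> (\<forall>x \<in> U i \<inter> U j \<inter> U k. t i j x \<otimes>\<^bsub>G\<^esub> t j k x = t i k x)"
      if "i \<in> I" "j \<in> I" "k \<in> I" for i j k
    proof -
      have "{x \<in> (U i \<inter> U j) \<inter> (U j \<inter> U k). (t i j x, t j k x) \<in> carrier G \<times> carrier G}
          = U i \<inter> U j \<inter> U k"
        using cl that by auto
      then show ?thesis by (auto simp: lie_group_obj_def pmap_calculus)
    qed
    have inv: "?p j i = ?p i j \<Zsemi> ginv ?K \<longleftrightarrow> (\<forall>x \<in> U i \<inter> U j. t j i x = inv\<^bsub>G\<^esub> (t i j x))"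
      if "i \<in> I" "j \<in> I" for i j
    proof -
      have "{x \<in> U i \<inter> U j. t i j x \<in> carrier G} = U i \<inter> U j"
        using cl that by auto
      then show ?thesis by (auto simp: lie_group_obj_def pmap_calculus pmap_eq_iff)
    qed
    have "t j i x = inv\<^bsub>G\<^esub> (t i j x)"
      if "smooth_cocycle G M I U t" "i \<in> I" "j \<in> I" "x \<in> U i \<inter> U j" for i j x
    proof -
      have "t j i x \<otimes>\<^bsub>G\<^esub> t i j x = \<one>\<^bsub>G\<^esub>"
        using that by (auto simp: smooth_cocycle_def)
      then show ?thesis using cl that by (metis Int_commute inv_equality)
    qed
    then have "smooth_cocycle G M I U t \<longleftrightarrow> smooth_cocycle G M I U t \<and>
        (\<forall>i\<in>I. \<forall>j\<in>I. \<forall>x \<in> U i \<inter> U j. t j i x = inv\<^bsub>G\<^esub> (t i j x))"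
      by blast
    also have "\<dots> \<longleftrightarrow> G_atlas ?K M I (\<lambda>i\<in>I. \<lambda>j\<in>I. ?p i j)"
      by (simp add: G_atlas_def smooth_cocycle_def mor mult unit inv cong: ball_cong)
    finally show ?thesis by blast
  next
    case False
    then show ?thesis
      by (simp add: G_atlas_def smooth_cocycle_def mor cong: ball_cong) blast
  qed
qed

text \<open>The inverse of a trivialization over \<open>U\<close> sends \<open>(x, f)\<close> into the fibre over \<open>x\<close>, hence into
  \<open>q\<^sup>-\<^sup>1(V)\<close> exactly if \<open>x \<in> V\<close>.  This gives the domain of the left hand side of the transition equation.\<close>

lemma pinv_pcomp_chart:
  assumes iso: "partial_iso E (prod_mfld M F) (pmap (preim E q U) a)"
    and im: "a ` preim E q U = U \<times> pts F"
    and fib: "\<And>x. x \<in> preim E q U \<Longrightarrow> fst (a x) = q x"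
  shows "pinv E (prod_mfld M F) (pmap (preim E q U) a) \<Zsemi> pmap (preim E q V) b =
    pmap ((V \<inter> U) \<times> pts F) (\<lambda>p. b (inv_into (preim E q U) a p))"
proof -
  let ?s = "inv_into (preim E q U) a"
  have s: "?s p \<in> preim E q U \<and> q (?s p) = fst p" if "p \<in> U \<times> pts F" for p
  proof -
    have "p \<in> a ` preim E q U" using that im by simp
    then show ?thesis using fib by (metis inv_into_into f_inv_into_f)
  qed
  have "{p \<in> U \<times> pts F. ?s p \<in> preim E q V} = (V \<inter> U) \<times> pts F"
    using s by (fastforce simp: preim_def)
  then show ?thesis
    by (simp add: pinv_pmap[OF iso] im pcomp_pmap)
qed

text \<open>The right hand side of the transition equation; it is defined over the whole domain of \<open>t\<close>
  because \<open>t\<close> takes values in the group.\<close>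

lemma left_translation_pmap:
  assumes G: "Lie_group G" and "T \<subseteq> pts M" and "\<And>x. x \<in> T \<Longrightarrow> t x \<in> carrier G"
  shows "ppair (pi0 M (lie_mfld G))
        (ppair (pi0 M (lie_mfld G) \<Zsemi> pmap T t) (pi1 M (lie_mfld G)) \<Zsemi> gmul (lie_group_obj G))
      = pmap (T \<times> pts (lie_mfld G)) (\<lambda>p. (fst p, t (fst p) \<otimes>\<^bsub>G\<^esub> snd p))"
proof -
  have "carrier G = pts (lie_mfld G)" using G by (simp add: Lie_group_def)
  then show ?thesis
    using assms by (auto simp: lie_group_obj_def pmap_calculus pmap_eq_iff)
qed

section \<open>Both notions in terms of the same data\<close>

text \<open>The common content of both notions, phrased on the representation used for classical bundles but
  with trivializations as partial isomorphisms.\<close>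

definition principal_bundle_data ::
    "'g lie_group \<Rightarrow> 'm mfld \<Rightarrow> ('e, 'm, 'g, 'g, 'i) cl_bundle \<Rightarrow> bool" where
  "principal_bundle_data G M B \<longleftrightarrow>
    (let E = cl_tot B; q = cl_proj B; I = cl_index B; U = cl_cover B;
         a = cl_triv B; t = cl_trans B; L = lie_mfld G in
      smooth_manifold E \<and> smooth_map E M q \<and> (\<forall>i\<in>I. openin (mtop M) (U i)) \<and>
      (\<forall>i\<in>I. partial_iso E (prod_mfld M L) (pmap (preim E q (U i)) (a i)) \<and>
         a i ` preim E q (U i) = U i \<times> pts L \<and> (\<forall>x\<in>preim E q (U i). fst (a i x) = q x)) \<and>
      (\<Union>i\<in>I. U i) = pts M \<and>
      smooth_cocycle G M I U t \<and>
      (\<forall>i\<in>I. \<forall>j\<in>I. \<forall>x \<in> U i \<inter> U j. \<forall>f \<in> pts L.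
         a i (inv_into (preim E q (U j)) (a j) (x, f)) = (x, t i j x \<otimes>\<^bsub>G\<^esub> f)))"

definition cl_extensional :: "('e, 'm, 'f, 'g, 'i) cl_bundle \<Rightarrow> bool" where
  "cl_extensional B \<longleftrightarrow>
    (let E = cl_tot B; q = cl_proj B; I = cl_index B; U = cl_cover B in
      q \<in> extensional (pts E) \<and> U \<in> extensional I \<and>
      cl_triv B \<in> extensional I \<and> (\<forall>i\<in>I. cl_triv B i \<in> extensional (preim E q (U i))) \<and>
      cl_trans B \<in> extensional I \<and> (\<forall>i\<in>I. cl_trans B i \<in> extensional I) \<and>
      (\<forall>i\<in>I. \<forall>j\<in>I. cl_trans B i j \<in> extensional (U i \<inter> U j)))"

lemma smooth_left_action_mult:
  assumes G: "Lie_group G"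
  shows "smooth_left_action G (lie_mfld G) (\<lambda>g h. g \<otimes>\<^bsub>G\<^esub> h)"
proof -
  interpret group G using G by (simp add: Lie_group_def)
  have "carrier G = pts (lie_mfld G)" using G by (simp add: Lie_group_def)
  then show ?thesis
    using G by (auto simp: smooth_left_action_def Lie_group_def m_assoc)
qed

text \<open>Local triviality of a classical fibre bundle is subsumed under the atlas, and the action axioms
  are those of left multiplication.\<close>

lemma classical_principal_bundle_iff:
  assumes M: "smooth_manifold M" and G: "Lie_group G"
  shows "classical_principal_bundle G M B \<longleftrightarrow> principal_bundle_data G M B \<and> cl_extensional B"
proof -
  let ?E = "cl_tot B" and ?q = "cl_proj B" and ?I = "cl_index B" and ?U = "cl_cover B"
    and ?a = "cl_triv B" and ?t = "cl_trans B" and ?L = "lie_mfld G"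
  let ?trans = "\<forall>i\<in>?I. \<forall>j\<in>?I. \<forall>x \<in> ?U i \<inter> ?U j. \<forall>f \<in> pts ?L.
         ?a i (inv_into (preim ?E ?q (?U j)) (?a j) (x, f)) = (x, ?t i j x \<otimes>\<^bsub>G\<^esub> f)"
  have L: "smooth_manifold ?L" using G by (simp add: Lie_group_def)
  have atlas: "(\<forall>i\<in>?I. local_trivialization ?E ?q M ?L (?U i) (?a i)) \<longleftrightarrow>
      (\<forall>i\<in>?I. openin (mtop M) (?U i)) \<and>
      (\<forall>i\<in>?I. partial_iso ?E (prod_mfld M ?L) (pmap (preim ?E ?q (?U i)) (?a i)) \<and>
         ?a i ` preim ?E ?q (?U i) = ?U i \<times> pts ?L \<and>
         (\<forall>x\<in>preim ?E ?q (?U i). fst (?a i x) = ?q x))"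
    if "smooth_manifold ?E" "smooth_map ?E M ?q"
  proof -
    have "local_trivialization ?E ?q M ?L V a \<Longrightarrow> openin (mtop M) V" for V a
      by (simp add: local_trivialization_def)
    moreover note local_trivialization_iff[OF smooth_manifold_charted[OF that(1)] smooth_manifold_charted[OF M]
        smooth_manifold_charted[OF L] that(2)]
    ultimately show ?thesis by meson
  qed
  have classical: "classical_principal_bundle G M B \<longleftrightarrow>
      classical_fibre_bundle ?E ?q M ?L \<and> fibre_bundle_atlas ?E ?q M ?L ?I ?U ?a \<and>
      smooth_cocycle G M ?I ?U ?t \<and> ?trans \<and> cl_extensional B"
    by (simp add: classical_principal_bundle_def classical_G_bundle_def smooth_cocycle_def
        cl_extensional_def Let_def G smooth_left_action_mult[OF G] conj_assoc)
  have "fibre_bundle_atlas ?E ?q M ?L ?I ?U ?a \<Longrightarrow> \<forall>x\<in>pts M. \<exists>V a. x \<in> V \<and> local_trivialization ?E ?q M ?L V a"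
    unfolding fibre_bundle_atlas_def by blast
  then have "classical_principal_bundle G M B \<longleftrightarrow>
      (smooth_manifold ?E \<and> smooth_map ?E M ?q) \<and> fibre_bundle_atlas ?E ?q M ?L ?I ?U ?a \<and>
      smooth_cocycle G M ?I ?U ?t \<and> ?trans \<and> cl_extensional B"
    unfolding classical classical_fibre_bundle_def using M L by argo
  also have "\<dots> \<longleftrightarrow> principal_bundle_data G M B \<and> cl_extensional B"
    by (auto simp only: fibre_bundle_atlas_def atlas principal_bundle_data_def Let_def cong: conj_cong)
  finally show ?thesis .
qed

text \<open>The axioms correspond one by one, except for the cover: with nonempty fibres, the sets \<open>U\<^sub>i\<close> cover \<open>M\<close> if and only if their preimages cover \<open>E\<close> and
  \<open>q\<close> is surjective.\<close>

lemma as_partial_iff: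
  assumes M: "smooth_manifold M" and G: "Lie_group G"
  shows "principal_bundle (lie_group_obj G) M (as_partial B) \<and> par_surjective M (as_partial B)
    \<longleftrightarrow> principal_bundle_data G M B"
proof -
  let ?E = "cl_tot B" and ?q = "cl_proj B" and ?I = "cl_index B" and ?U = "cl_cover B"
    and ?a = "cl_triv B" and ?t = "cl_trans B" and ?L = "lie_mfld G"
  let ?P = "\<lambda>i. preim ?E ?q (?U i)"
  interpret group G using G by (simp add: Lie_group_def)
  have L: "smooth_manifold ?L" and C: "carrier G = pts ?L" using G by (simp_all add: Lie_group_def)
  \<comment> \<open>The conditions in this case distinction follow from either side.  They are needed before the
    composites in the transition equations can be evaluated.\<close>
  show ?thesis
  proof (cases "smooth_manifold ?E \<and> smooth_map ?E M ?q \<and> (\<forall>i\<in>?I. openin (mtop M) (?U i))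
      \<and> smooth_cocycle G M ?I ?U ?t \<and>
      (\<forall>i\<in>?I. partial_iso ?E (prod_mfld M ?L) (pmap (?P i) (?a i)) \<and>
         ?a i ` ?P i = ?U i \<times> pts ?L \<and> (\<forall>x\<in>?P i. fst (?a i x) = ?q x))")
    case True
    then have E: "smooth_manifold ?E" and q: "smooth_map ?E M ?q"
      and U: "\<And>i. i \<in> ?I \<Longrightarrow> openin (mtop M) (?U i)" and t: "smooth_cocycle G M ?I ?U ?t"
      and iso: "\<And>i. i \<in> ?I \<Longrightarrow> partial_iso ?E (prod_mfld M ?L) (pmap (?P i) (?a i))"
      and im: "\<And>i. i \<in> ?I \<Longrightarrow> ?a i ` ?P i = ?U i \<times> pts ?L"
      and fib: "\<And>i x. i \<in> ?I \<Longrightarrow> x \<in> ?P i \<Longrightarrow> fst (?a i x) = ?q x"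
      by auto
    have sub: "?U i \<subseteq> pts M" if "i \<in> ?I" for i
      using U[OF that] by (rule openin_subset)
    have cl: "?t j i x \<in> carrier G" if "i \<in> ?I" "j \<in> ?I" "x \<in> ?U j \<inter> ?U i" for i j x
      using smooth_cocycle_closed[OF G t U] that by blast
    have trans: "pinv ?E (prod_mfld M ?L) (pmap (?P i) (?a i)) \<Zsemi> pmap (?P j) (?a j) =
        ppair (pi0 M ?L) (ppair (pi0 M ?L \<Zsemi> pmap (?U j \<inter> ?U i) (?t j i)) (pi1 M ?L) \<Zsemi> gmul (lie_group_obj G))
      \<longleftrightarrow> (\<forall>x \<in> ?U j \<inter> ?U i. \<forall>f \<in> pts ?L. ?a j (inv_into (?P i) (?a i) (x, f)) = (x, ?t j i x \<otimes>\<^bsub>G\<^esub> f))"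
      if "i \<in> ?I" "j \<in> ?I" for i j
    proof -
      have "?U j \<inter> ?U i \<subseteq> pts M" using sub[OF that(1)] by blast
      note left_translation_pmap[OF G this cl[OF that]]
      then show ?thesis
        using that by (simp add: pinv_pcomp_chart[OF iso im fib] pmap_eq_iff)
    qed
    have qim: "?q ` pts ?E \<subseteq> pts M"
      using q by (auto simp: smooth_map_def continuous_map_def)
    \<comment> \<open>The unit of the group provides a point in every fibre over \<open>U\<^sub>i\<close>.\<close>
    have Uim: "?U i \<subseteq> ?q ` pts ?E" if "i \<in> ?I" for i
    proof
      fix x assume "x \<in> ?U i"
      then have "(x, \<one>\<^bsub>G\<^esub>) \<in> ?a i ` ?P i" using im[OF that] one_closed C by simp
      then obtain y where "y \<in> ?P i" "(x, \<one>\<^bsub>G\<^esub>) = ?a i y" by blast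
      then have "y \<in> ?P i" "fst (?a i y) = x" by (auto dest: arg_cong[where f = fst])
      then show "x \<in> ?q ` pts ?E" using fib[OF that] by (auto simp: preim_def)
    qed
    have cover: "pmap (\<Union>i\<in>?I. ?P i) (\<lambda>x. x) = pmap (pts ?E) (\<lambda>x. x) \<and> ?q ` pts ?E = pts M
        \<longleftrightarrow> (\<Union>i\<in>?I. ?U i) = pts M"
    proof -
      have "(\<Union>i\<in>?I. ?P i) = pts ?E \<longleftrightarrow> ?q ` pts ?E \<subseteq> (\<Union>i\<in>?I. ?U i)"
        by (auto simp: preim_def)
      then have "pmap (\<Union>i\<in>?I. ?P i) (\<lambda>x. x) = pmap (pts ?E) (\<lambda>x. x) \<longleftrightarrow> ?q ` pts ?E \<subseteq> (\<Union>i\<in>?I. ?U i)"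
        by (simp add: pmap_eq_iff)
      moreover have "(\<Union>i\<in>?I. ?U i) \<subseteq> ?q ` pts ?E" "(\<Union>i\<in>?I. ?U i) \<subseteq> pts M"
        using Uim sub by (auto intro!: UN_least)
      ultimately show ?thesis
        using qim by (metis subset_antisym)
    qed
    have chart: "pmap (?P i) (?a i) \<Zsemi> pi0 M ?L = rst (pmap (?P i) (?a i)) \<Zsemi> pmap (pts ?E) ?q \<and>
        rst (pinv ?E (prod_mfld M ?L) (pmap (?P i) (?a i))) = pprod M ?L (pmap (?U i) (\<lambda>x. x)) (ident ?L)"
      if "i \<in> ?I" for i
      using fibre_bundle_chart_iff[OF sub[OF that]] iso im fib that by blast
    have atlas: "G_atlas (lie_group_obj G) M ?I (\<lambda>i\<in>?I. \<lambda>j\<in>?I. pmap (?U i \<inter> ?U j) (?t i j))"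
      using G_atlas_iff[where U = ?U and I = ?I and t = ?t, OF M G U] t by blast
    have "fibre_bundle M ?L ?E (pmap (pts ?E) ?q) ?I (\<lambda>i\<in>?I. pmap (?P i) (?a i)) (\<lambda>i\<in>?I. pmap (?U i) (\<lambda>x. x))
        \<and> ?q ` pts ?E = pts M \<longleftrightarrow> (\<Union>i\<in>?I. ?U i) = pts M"
    proof -
      have "pjoin ?I (\<lambda>i. rst ((\<lambda>i\<in>?I. pmap (?P i) (?a i)) i)) = pjoin ?I (\<lambda>i. pmap (?P i) (\<lambda>x. x))"
        by (auto simp: pjoin_def rst_pmap fun_eq_iff cong: conj_cong bex_cong)
      then have "pjoin ?I (\<lambda>i. rst ((\<lambda>i\<in>?I. pmap (?P i) (?a i)) i)) = pmap (\<Union>i\<in>?I. ?P i) (\<lambda>x. x)"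
        by (simp add: pjoin_identities)
      moreover have "mor ?E M (pmap (pts ?E) ?q)"
        using q mor_pmap_total[OF smooth_manifold_charted[OF E] smooth_manifold_charted[OF M]] by simp
      moreover have "total ?E (pmap (pts ?E) ?q)"
        by (simp add: total_def rst_pmap ident_def)
      ultimately show ?thesis
        using M L E U iso chart cover
        by (simp add: fibre_bundle_def restriction_idempotent_iff[OF M] ident_def cong: ball_cong)
    qed
    moreover have "principal_bundle (lie_group_obj G) M (as_partial B) \<longleftrightarrow>
        fibre_bundle M ?L ?E (pmap (pts ?E) ?q) ?I (\<lambda>i\<in>?I. pmap (?P i) (?a i)) (\<lambda>i\<in>?I. pmap (?U i) (\<lambda>x. x)) \<and>
        (\<forall>i\<in>?I. \<forall>j\<in>?I. \<forall>x \<in> ?U j \<inter> ?U i. \<forall>f \<in> pts ?L.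
          ?a j (inv_into (?P i) (?a i) (x, f)) = (x, ?t j i x \<otimes>\<^bsub>G\<^esub> f))"
      using group_object_lie_group_obj[OF G] atlas
      by (simp add: principal_bundle_def as_partial_def Let_def trans cong: ball_cong)
    moreover have "par_surjective M (as_partial B) \<longleftrightarrow> ?q ` pts ?E = pts M"
      by (simp add: par_surjective_def as_partial_def Let_def ran_pmap)
    \<comment> \<open>The two indices are interchanged here: the diagrammatic composite \<open>\<alpha>\<^sub>i\<^sup>* \<alpha>\<^sub>j\<close> corresponds to the
      classical transition function with values \<open>\<tau>\<^sub>j\<^sub>i\<close>.\<close>
    moreover have "principal_bundle_data G M B \<longleftrightarrow> (\<Union>i\<in>?I. ?U i) = pts M \<and>
        (\<forall>j\<in>?I. \<forall>i\<in>?I. \<forall>x \<in> ?U j \<inter> ?U i. \<forall>f \<in> pts ?L.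
          ?a j (inv_into (?P i) (?a i) (x, f)) = (x, ?t j i x \<otimes>\<^bsub>G\<^esub> f))"
      unfolding principal_bundle_data_def Let_def using True by argo
    ultimately show ?thesis by blast
  next
    case False
    have "principal_bundle_data G M B" if P: "principal_bundle (lie_group_obj G) M (as_partial B)"
    proof -
      have FB: "fibre_bundle M ?L ?E (pmap (pts ?E) ?q) ?I (\<lambda>i\<in>?I. pmap (?P i) (?a i))
          (\<lambda>i\<in>?I. pmap (?U i) (\<lambda>x. x))"
        and GA: "G_atlas (lie_group_obj G) M ?I (\<lambda>i\<in>?I. \<lambda>j\<in>?I. pmap (?U i \<inter> ?U j) (?t i j))"
        using P by (simp_all add: principal_bundle_def as_partial_def Let_def)
      have E: "smooth_manifold ?E" and "mor ?E M (pmap (pts ?E) ?q)"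
        using FB by (simp_all add: fibre_bundle_def)
      then have q: "smooth_map ?E M ?q"
        using mor_pmap_total[OF smooth_manifold_charted[OF E] smooth_manifold_charted[OF M]] by simp
      have U: "openin (mtop M) (?U i)" if "i \<in> ?I" for i
        using FB that restriction_idempotent_iff[OF M, of "?U i"] by (simp add: fibre_bundle_def)
      have "partial_iso ?E (prod_mfld M ?L) (pmap (?P i) (?a i)) \<and>
         ?a i ` ?P i = ?U i \<times> pts ?L \<and> (\<forall>x\<in>?P i. fst (?a i x) = ?q x)" if "i \<in> ?I" for i
        using FB that fibre_bundle_chart_iff[OF openin_subset[OF U[OF that]], of ?E ?L ?q "?a i"]
        by (simp add: fibre_bundle_def)
      then show ?thesis
        using False E q U G_atlas_iff[where U = ?U and I = ?I and t = ?t, OF M G U] GA by blast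
    qed
    moreover have "\<not> principal_bundle_data G M B"
      using False by (auto simp: principal_bundle_data_def Let_def)
    ultimately show ?thesis by blast
  qed
qed

lemma par_totally_fibred_as_partial: "par_totally_fibred (as_partial B)"
  by (auto simp: par_totally_fibred_def totally_fibred_def as_partial_def Let_def pmap_calculus
      pmap_eq_iff preim_def)

section \<open>The correspondence\<close>

text \<open>Each open set is recovered as the domain of an arrow.  The restrictions produce the
  default value outside these sets, as required for classical bundles.\<close>

definition as_classical :: "('e, 'm, 'g, 'i) par_bundle \<Rightarrow> ('e, 'm, 'g, 'g, 'i) cl_bundle" where
  "as_classical P =
    (let E = par_tot P; I = par_index P in
      \<lparr>cl_tot = E,
       cl_proj = (\<lambda>x\<in>pts E. the (par_proj P x)),
       cl_index = I,
       cl_cover = (\<lambda>i\<in>I. dom (par_idem P i)),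
       cl_triv = (\<lambda>i\<in>I. \<lambda>x\<in>dom (par_triv P i). the (par_triv P i x)),
       cl_trans = (\<lambda>i\<in>I. \<lambda>j\<in>I. \<lambda>x\<in>dom (par_trans P i j). the (par_trans P i j x))\<rparr>)"

lemma restrict_eqI: "g \<in> extensional I \<Longrightarrow> (\<And>i. i \<in> I \<Longrightarrow> f i = g i) \<Longrightarrow> restrict f I = g"
  by (rule extensionalityI[where A = I]) auto

lemma as_classical_as_partial:
  assumes "cl_extensional B"
  shows "as_classical (as_partial B) = B"
proof -
  have the_pmap: "(\<lambda>x\<in>S. the (pmap S f x)) = f" if "f \<in> extensional S" for S f
    using that by (intro extensionalityI[where A = S]) (auto simp: pmap_apply)
  let ?I = "cl_index B" and ?U = "cl_cover B" and ?P = "\<lambda>i. preim (cl_tot B) (cl_proj B) (cl_cover B i)"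
  have "(\<lambda>x\<in>pts (cl_tot B). the (pmap (pts (cl_tot B)) (cl_proj B) x)) = cl_proj B"
    using assms by (simp add: the_pmap cl_extensional_def Let_def)
  moreover have "(\<lambda>i\<in>?I. dom ((\<lambda>i\<in>?I. pmap (?U i) (\<lambda>x. x)) i)) = ?U"
    using assms by (intro restrict_eqI) (simp_all add: cl_extensional_def Let_def)
  moreover have "(\<lambda>i\<in>?I. \<lambda>x\<in>dom ((\<lambda>i\<in>?I. pmap (?P i) (cl_triv B i)) i).
      the ((\<lambda>i\<in>?I. pmap (?P i) (cl_triv B i)) i x)) = cl_triv B"
    using assms by (intro restrict_eqI) (auto simp: cl_extensional_def Let_def the_pmap pmap_apply)
  moreover have "(\<lambda>i\<in>?I. \<lambda>j\<in>?I. \<lambda>x\<in>dom ((\<lambda>i\<in>?I. \<lambda>j\<in>?I. pmap (?U i \<inter> ?U j) (cl_trans B i j)) i j).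
      the ((\<lambda>i\<in>?I. \<lambda>j\<in>?I. pmap (?U i \<inter> ?U j) (cl_trans B i j)) i j x)) = cl_trans B"
    using assms by (intro restrict_eqI) (auto simp: cl_extensional_def Let_def the_pmap pmap_apply)
  ultimately show ?thesis
    by (simp add: as_classical_def as_partial_def Let_def)
qed

lemma pmap_restrict: "pmap (dom f) (\<lambda>x\<in>dom f. the (f x)) = f"
  by (auto simp: fun_eq_iff pmap_apply domIff)

lemma dom_rst: "dom (rst f) = dom f"
  by (simp add: rst_def)

lemma dom_pcomp: "dom (f \<Zsemi> g) = {x \<in> dom f. the (f x) \<in> dom g}"
  by (auto simp: pcomp_def map_comp_def split: option.splits)

lemma mor_closed:
  assumes "mor A B f" and "x \<in> dom f"
  shows "x \<in> pts A" and "the (f x) \<in> pts B"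
proof -
  have "openin (mtop A) (dom f)" and "continuous_map (subtopology (mtop A) (dom f)) (mtop B) (\<lambda>x. the (f x))"
    using assms(1) by (simp_all add: mor_def smooth_map_def)
  then show "x \<in> pts A" and "the (f x) \<in> pts B"
    using assms(2) by (auto simp: continuous_map_def Pi_iff dest: openin_subset)
qed

text \<open>These are the domains that \<^const>\<open>as_partial\<close> prescribes.  The one of \<open>\<tau>\<^sub>i\<^sub>j\<close> comes from the
  transition equation: its two sides have the domains \<open>(U\<^sub>i \<inter> U\<^sub>j) \<times> G\<close> and \<open>dom \<tau>\<^sub>i\<^sub>j \<times> G\<close>, and \<open>G\<close> is inhabited.\<close>

lemma principal_bundle_domains:
  assumes G: "Lie_group G" and P: "principal_bundle (lie_group_obj G) M P" and T: "par_totally_fibred P"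
  shows "dom (par_proj P) = pts (par_tot P)"
    and "i \<in> par_index P \<Longrightarrow> par_idem P i = pmap (dom (par_idem P i)) (\<lambda>x. x)"
    and "i \<in> par_index P \<Longrightarrow>
      dom (par_triv P i) = preim (par_tot P) (\<lambda>x. the (par_proj P x)) (dom (par_idem P i))"
    and "i \<in> par_index P \<Longrightarrow> j \<in> par_index P \<Longrightarrow>
      dom (par_trans P i j) = dom (par_idem P i) \<inter> dom (par_idem P j)"
proof -
  let ?E = "par_tot P" and ?I = "par_index P" and ?L = "lie_mfld G"
  let ?q = "\<lambda>x. the (par_proj P x)" and ?U = "\<lambda>i. dom (par_idem P i)"
  let ?P = "\<lambda>i. preim ?E ?q (?U i)" and ?a = "\<lambda>i x. the (par_triv P i x)"
  have FB: "fibre_bundle M ?L ?E (par_proj P) ?I (par_triv P) (par_idem P)"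
    and GA: "G_atlas (lie_group_obj G) M ?I (par_trans P)"
    and tr: "\<And>i j. i \<in> ?I \<Longrightarrow> j \<in> ?I \<Longrightarrow> pinv ?E (prod_mfld M ?L) (par_triv P i) \<Zsemi> par_triv P j
         = ppair (pi0 M ?L) (ppair (pi0 M ?L \<Zsemi> par_trans P j i) (pi1 M ?L) \<Zsemi> gmul (lie_group_obj G))"
    using P by (simp_all add: principal_bundle_def Let_def)
  have q: "rst (par_proj P) = ident ?E" using FB by (simp add: fibre_bundle_def total_def)
  from arg_cong[OF this, of dom] show dq: "dom (par_proj P) = pts ?E"
    by (simp add: dom_rst ident_def)
  have e: "restriction_idempotent M (par_idem P i)" if "i \<in> ?I" for i
    using FB that by (simp add: fibre_bundle_def)
  then show e': "par_idem P i = pmap (?U i) (\<lambda>x. x)" if "i \<in> ?I" for i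
    using that by (simp add: restriction_idempotent_def rst_def)
  show da: "dom (par_triv P i) = ?P i" if "i \<in> ?I" for i
  proof -
    have "rst (par_triv P i) = rst (par_proj P \<Zsemi> par_idem P i)"
      using T that by (simp add: par_totally_fibred_def totally_fibred_def)
    from arg_cong[OF this, of dom] show ?thesis
      by (simp add: dom_rst dom_pcomp dq preim_def)
  qed
  have sub: "?U i \<subseteq> pts M" if "i \<in> ?I" for i
    using e[OF that] mor_closed(1) by (fastforce simp: restriction_idempotent_def)
  have a: "par_triv P i = pmap (?P i) (?a i)" if "i \<in> ?I" for i
    using pmap_dom_the[of "par_triv P i"] da[OF that] by simp
  have qq: "par_proj P = pmap (pts ?E) ?q"
    using pmap_dom_the[of "par_proj P"] dq by simp
  have chart: "partial_iso ?E (prod_mfld M ?L) (pmap (?P i) (?a i)) \<and>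
      ?a i ` ?P i = ?U i \<times> pts ?L \<and> (\<forall>x\<in>?P i. fst (?a i x) = ?q x)" if "i \<in> ?I" for i
  proof -
    have "partial_iso ?E (prod_mfld M ?L) (par_triv P i) \<and>
        par_triv P i \<Zsemi> pi0 M ?L = rst (par_triv P i) \<Zsemi> par_proj P \<and>
        rst (pinv ?E (prod_mfld M ?L) (par_triv P i)) = pprod M ?L (par_idem P i) (ident ?L)"
      using FB that by (simp add: fibre_bundle_def)
    then have "partial_iso ?E (prod_mfld M ?L) (pmap (?P i) (?a i)) \<and>
        pmap (?P i) (?a i) \<Zsemi> pi0 M ?L = rst (pmap (?P i) (?a i)) \<Zsemi> pmap (pts ?E) ?q \<and>
        rst (pinv ?E (prod_mfld M ?L) (pmap (?P i) (?a i))) = pprod M ?L (pmap (?U i) (\<lambda>x. x)) (ident ?L)"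
      by (simp only: a[OF that, symmetric] qq[symmetric] e'[OF that, symmetric])
    then show ?thesis
      by (rule iffD1[OF fibre_bundle_chart_iff[OF sub[OF that], of ?E ?L ?q "?a i"]])
  qed
  show "dom (par_trans P i j) = ?U i \<inter> ?U j" if ij: "i \<in> ?I" "j \<in> ?I"
  proof -
    have "\<forall>i\<in>?I. \<forall>j\<in>?I. mor M (gobj (lie_group_obj G)) (par_trans P i j)"
      using GA unfolding G_atlas_def by (rule conjunct1)
    then have "mor M ?L (par_trans P i j)" using ij by simp
    note cl = mor_closed[OF this]
    interpret group G using G by (simp add: Lie_group_def)
    have C: "carrier G = pts ?L" using G by (simp add: Lie_group_def)
    have "pinv ?E (prod_mfld M ?L) (pmap (?P j) (?a j)) \<Zsemi> pmap (?P i) (?a i)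
        = pmap ((?U i \<inter> ?U j) \<times> pts ?L) (\<lambda>p. ?a i (inv_into (?P j) (?a j) p))"
      using chart[OF ij(2)] by (intro pinv_pcomp_chart) auto
    then have "pinv ?E (prod_mfld M ?L) (par_triv P j) \<Zsemi> par_triv P i
        = pmap ((?U i \<inter> ?U j) \<times> pts ?L) (\<lambda>p. ?a i (inv_into (?P j) (?a j) p))"
      by (simp only: a[OF ij(1), symmetric] a[OF ij(2), symmetric])
    moreover have "ppair (pi0 M ?L) (ppair (pi0 M ?L \<Zsemi> par_trans P i j) (pi1 M ?L) \<Zsemi> gmul (lie_group_obj G))
        = pmap (dom (par_trans P i j) \<times> pts ?L)
            (\<lambda>p. (fst p, the (par_trans P i j (fst p)) \<otimes>\<^bsub>G\<^esub> snd p))"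
      using left_translation_pmap[OF G, of "dom (par_trans P i j)" M "\<lambda>x. the (par_trans P i j x)"] cl
      by (simp add: pmap_dom_the subset_iff C)
    ultimately have "(?U i \<inter> ?U j) \<times> pts ?L = dom (par_trans P i j) \<times> pts ?L"
      using tr[OF ij(2,1)] by (simp add: pmap_eq_iff)
    then show ?thesis using one_closed unfolding C by blast
  qed
qed

lemma as_partial_as_classical:
  assumes G: "Lie_group G" and P: "principal_bundle (lie_group_obj G) M P" and T: "par_totally_fibred P"
  shows "as_partial (as_classical P) = P" and "cl_extensional (as_classical P)"
proof -
  let ?E = "par_tot P" and ?I = "par_index P"
  let ?q = "\<lambda>x\<in>pts ?E. the (par_proj P x)" and ?U = "\<lambda>i\<in>?I. dom (par_idem P i)"
  note dom = principal_bundle_domains[OF G P T]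
  have ext: "par_triv P \<in> extensional ?I" "par_idem P \<in> extensional ?I"
      "par_trans P \<in> extensional ?I" "\<And>i. i \<in> ?I \<Longrightarrow> par_trans P i \<in> extensional ?I"
    using P by (simp_all add: principal_bundle_def Let_def)
  have preim: "preim ?E ?q (?U i) = dom (par_triv P i)" if "i \<in> ?I" for i
    using dom(3)[OF that] that by (auto simp: preim_def)
  have "pmap (pts ?E) ?q = par_proj P"
    using pmap_restrict[of "par_proj P"] dom(1) by simp
  moreover have "(\<lambda>i\<in>?I. pmap (preim ?E ?q (?U i)) ((\<lambda>i\<in>?I. \<lambda>x\<in>dom (par_triv P i). the (par_triv P i x)) i))
      = par_triv P"
    using ext by (intro restrict_eqI) (simp_all add: preim pmap_restrict del: restrict_apply, simp add: pmap_restrict)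
  moreover have "(\<lambda>i\<in>?I. pmap (?U i) (\<lambda>x. x)) = par_idem P"
    using ext dom(2) by (intro restrict_eqI) simp_all
  moreover have "(\<lambda>i\<in>?I. \<lambda>j\<in>?I. pmap (?U i \<inter> ?U j)
      ((\<lambda>i\<in>?I. \<lambda>j\<in>?I. \<lambda>x\<in>dom (par_trans P i j). the (par_trans P i j x)) i j)) = par_trans P"
    using ext
    by (intro restrict_eqI) (simp_all add: dom(4)[symmetric] pmap_restrict)
  ultimately show "as_partial (as_classical P) = P"
    by (simp add: as_classical_def as_partial_def Let_def)
  show "cl_extensional (as_classical P)"
    using preim dom(4) by (simp add: cl_extensional_def as_classical_def Let_def)
qed

theorem proposition12:
  fixes M :: "'m mfld" and G :: "'g lie_group"
  assumes "smooth_manifold M" and "Lie_group G"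
  shows "bij_betw (as_partial :: ('e, 'm, 'g, 'g, 'i) cl_bundle \<Rightarrow> ('e, 'm, 'g, 'i) par_bundle)
    {B. classical_principal_bundle G M B}
    {P. principal_bundle (lie_group_obj G) M P \<and> par_totally_fibred P \<and> par_surjective M P}"
proof (rule bij_betw_byWitness[where f' = as_classical])
  let ?Cl = "{B :: ('e, 'm, 'g, 'g, 'i) cl_bundle. classical_principal_bundle G M B}"
    and ?Par = "{P :: ('e, 'm, 'g, 'i) par_bundle.
      principal_bundle (lie_group_obj G) M P \<and> par_totally_fibred P \<and> par_surjective M P}"
  note classical = classical_principal_bundle_iff[OF assms] and partial = as_partial_iff[OF assms]
  show "\<forall>B\<in>?Cl. as_classical (as_partial B) = B"
    by (simp add: classical as_classical_as_partial)
  show "\<forall>P\<in>?Par. as_partial (as_classical P) = P"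
    using as_partial_as_classical(1)[OF assms(2)] by blast
  show "as_partial ` ?Cl \<subseteq> ?Par"
    using classical partial par_totally_fibred_as_partial by blast
  show "as_classical ` ?Par \<subseteq> ?Cl"
  proof (rule image_subsetI)
    fix P assume "P \<in> ?Par"
    then have P: "principal_bundle (lie_group_obj G) M P" "par_totally_fibred P" "par_surjective M P"
      by simp_all
    then have "principal_bundle_data G M (as_classical P)"
      using partial[of "as_classical P"] as_partial_as_classical(1)[OF assms(2) P(1,2)] by simp
    then show "as_classical P \<in> ?Cl"
      using as_partial_as_classical(2)[OF assms(2) P(1,2)] by (simp add: classical)
  qed
qed

end
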